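(* Let $p=3$, $n=4$, and let $l:(S^2)^4\to\mathbb{R}_{\ge0}$ be $l(v_1,\dots,v_4)=\max_{\delta\in\{-1,1\}^4}\left\|\sum_{i=1}^4\delta_iv_i\right\|^2$. Suppose $l$ attains a local minimum at $\underline{v}=(v_1,v_2,v_3,v_4)$, where $\operatorname{span}\{v_1,\dots,v_4\}=\mathbb{R}^3$ and $v_i\ne\pm v_j$ for any two indices $i\ne j$. Then $\underline{v}$ is either of cube type or of triangular pyramid type. If $\underline{v}$ is of cube type, then $l(\underline{v})=\frac{16}{3}$; if $\underline{v}$ is of triangular pyramid type, then $l(\underline{v})=5$. In particular, $l$ attains its global minimum at triangular pyramid type configurations, and $$\min_{\underline{v}\in(S^2)^4}\ \max_{\delta\in\{\pm1\}^4}\left\|\sum_{i=1}^4\delta_iv_i\right\|^2=5.$$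
   Context: $S^{2}=\{v\in\mathbb{R}^3:\|v\|=1\}$ with the Euclidean norm. The function $l$ attains a local minimum at $\underline{v}$ if $l(\underline{v})$ is the minimal value of $l$ on some neighborhood of $\underline{v}$ in $(S^2)^4$. The following types are understood up to permuting the vectors, replacing some of them by their negatives, and applying an element of $\mathrm{O}(3)$. A configuration $\underline{v}=(v_1,v_2,v_3,v_4)\in(S^2)^4$ is of cube type if $\{\pm v_1,\pm v_2,\pm v_3,\pm v_4\}$ are the $8$ vertices of a cube inscribed in $S^2$. It is of triangular pyramid type if $\pm v_1$ are the north and south poles and $v_2,v_3,v_4$ are the vertices of an equilateral triangle on the equator. *)

theory Defs
  imports "HOL-Analysis.Analysis"
begin

text \<open>A point of \<open>(\<real>\<^sup>3)\<^sup>4\<close> is an element of \<^typ>\<open>real^3^4\<close>, with \<open>v $ i\<close> the \<open>i\<close>-th vector. In the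
  index type \<open>4\<close> the indices are \<open>1, 2, 3, 4\<close> (where \<open>4 = 0\<close>), likewise \<open>1, 2, 3\<close> in the type \<open>3\<close>.\<close>

definition configurations :: "(real^3^4) set" where
  "configurations = {v. \<forall>i. v $ i \<in> sphere 0 1}"

definition sign_vectors :: "(real^'n) set" where
  "sign_vectors = {\<delta>. \<forall>i. \<delta> $ i \<in> {-1, 1}}"

definition max_sq_norm :: "real^3^4 \<Rightarrow> real" where
  "max_sq_norm v = Max ((\<lambda>\<delta>::real^4. (norm (\<Sum>i\<in>UNIV. \<delta> $ i *\<^sub>R v $ i))\<^sup>2) ` sign_vectors)"

definition attains_local_min_on ::
    "'a::topological_space set \<Rightarrow> ('a \<Rightarrow> real) \<Rightarrow> 'a \<Rightarrow> bool" where
  "attains_local_min_on S f x \<longleftrightarrow>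
     (\<exists>U. openin (top_of_set S) U \<and> x \<in> U \<and> (\<forall>y\<in>U. f x \<le> f y))"

text \<open>The two configurations agree up to permuting the vectors, changing signs of some of them, and
  applying an element of \<open>O(3)\<close>.\<close>

definition config_equiv :: "real^3^4 \<Rightarrow> real^3^4 \<Rightarrow> bool" where
  "config_equiv v w \<longleftrightarrow>
     (\<exists>\<pi> \<delta> f. bij \<pi> \<and> \<delta> \<in> sign_vectors \<and> orthogonal_transformation f \<and>
        (\<forall>i. w $ i = \<delta> $ i *\<^sub>R f (v $ \<pi> i)))"

text \<open>The vertex set of an arbitrary cube in \<open>\<real>\<^sup>3\<close>: the image of \<open>{-1, 1}\<^sup>3\<close>, the vertices of
  \<open>[-1, 1]\<^sup>3\<close>, under a similarity.\<close>

definition cube_vertices :: "(real^3) set \<Rightarrow> bool" where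
  "cube_vertices V \<longleftrightarrow>
     (\<exists>c s f. 0 < s \<and> orthogonal_transformation f \<and> V = (\<lambda>x. c + s *\<^sub>R f x) ` (sign_vectors :: (real^3) set))"

definition cube_type :: "real^3^4 \<Rightarrow> bool" where
  "cube_type v \<longleftrightarrow>
     (\<exists>w. config_equiv v w \<and>
        cube_vertices (\<Union>i. {w $ i, - (w $ i)}) \<and> (\<Union>i. {w $ i, - (w $ i)}) \<subseteq> sphere 0 1)"

definition equator :: "(real^3) set" where
  "equator = {x \<in> sphere 0 1. x $ 3 = 0}"

definition equilateral_triangle :: "real^3 \<Rightarrow> real^3 \<Rightarrow> real^3 \<Rightarrow> bool" where
  "equilateral_triangle a b c \<longleftrightarrow> a \<noteq> b \<and> dist a b = dist b c \<and> dist b c = dist c a"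

definition triangular_pyramid_type :: "real^3^4 \<Rightarrow> bool" where
  "triangular_pyramid_type v \<longleftrightarrow>
     (\<exists>w. config_equiv v w \<and>
        {w $ 1, - (w $ 1)} = {axis 3 1, - axis 3 1} \<and>
        {w $ 2, w $ 3, w $ 4} \<subseteq> equator \<and> equilateral_triangle (w $ 2) (w $ 3) (w $ 4))"

end

theory Submission
  imports Defs
begin

text \<open>
  For a spanning configuration \<open>v\<close> with Gram matrix \<open>G\<close>, the squared length of the sum with signs \<open>\<delta>\<close>
  is \<open>\<delta>\<^sup>T G \<delta>\<close>, a linear function of \<open>G\<close>. So a local minimum is a point on the boundary of the
  convex set of positive semidefinite matrices with unit diagonal at which a maximum of linear
  functions is locally minimal. The normal to the boundary is \<open>c c\<^sup>T\<close>, where \<open>c\<close> is the linear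
  dependency of the four vectors, and the boundary is strictly curved except in directions \<open>A\<close> with
  \<open>A c = 0\<close>. Hence a direction \<open>A\<close> with zero diagonal that increases no active value and satisfies
  \<open>c\<^sup>T A c \<le> 0\<close> and \<open>A c \<noteq> 0\<close> leads to smaller values: follow \<open>A\<close> and return to the boundary by
  shrinking the off-diagonal entries, which decreases the maximum because it exceeds the average
  value \<open>4\<close>. The analytic part of this is \<open>second_order_descent\<close>, and
  \<open>prescribed_gram_variation\<close> lifts variations of the Gram matrix to the vectors.

  The eight sign vectors up to \<open>\<plusminus>1\<close> split by parity into two orthogonal bases of \<open>\<real>\<^sup>4\<close>. Using the
  directions \<open>A = \<epsilon>\<epsilon>\<^sup>T - \<delta>\<delta>\<^sup>T\<close> with \<open>\<epsilon>\<close>, \<open>\<delta>\<close> from one basis, \<open>inactive_signs_isolated\<close> shows that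
  each basis contains at most one vector that does not attain the maximum. It contains at least one,
  because the values over a basis average to \<open>4\<close>. Six active values remain and determine
  the six inner products up to one parameter, which the linear dependency fixes; the result
  is the Gram matrix of a triangular pyramid (\<open>local_min_gram\<close>). Cubes are critical for the first-order
  condition only: at a cube all four values of one parity lie below the maximum, and moving two
  opposite inner products in opposite directions decreases the maximum to second order. The
  disjunction of the theorem therefore always holds through the triangular pyramid.

  For the global statement, a minimum exists by compactness. It is a triangular pyramid, with value
  \<open>5\<close>, if its vectors span \<open>\<real>\<^sup>3\<close>. Otherwise the vectors lie in a plane, and projecting them to three
  directions at angles of 60 degrees gives at least \<open>16/3\<close> (\<open>coplanar_lower_bound\<close>). The value
  \<open>16/3\<close> of a cube comes from its eight vertices forming a tight frame.
\<close>

section \<open>Signed sums\<close>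

definition signed_sum :: "real^3^4 \<Rightarrow> real^4 \<Rightarrow> real^3" where
  "signed_sum v \<delta> = (\<Sum>i\<in>UNIV. \<delta> $ i *\<^sub>R v $ i)"

lemma signed_sum_add: "signed_sum (v + w) \<delta> = signed_sum v \<delta> + signed_sum w \<delta>"
  by (simp add: signed_sum_def scaleR_add_right sum.distrib)

lemma signed_sum_scaleR: "signed_sum (t *\<^sub>R v) \<delta> = t *\<^sub>R signed_sum v \<delta>"
  by (simp add: signed_sum_def scaleR_sum_right mult.commute)

lemma signed_sum_diff: "signed_sum (v - w) \<delta> = signed_sum v \<delta> - signed_sum w \<delta>"
  by (simp add: signed_sum_def scaleR_diff_right sum_subtractf)

lemma sign_vectors_abs: "\<delta> \<in> sign_vectors \<Longrightarrow> \<bar>\<delta> $ i\<bar> = 1"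
  by (auto simp: sign_vectors_def abs_if dest!: spec[of _ i])

lemma sign_vectors_sq: "\<delta> \<in> sign_vectors \<Longrightarrow> \<delta> $ i * \<delta> $ i = 1"
  by (auto simp: sign_vectors_def dest!: spec[of _ i])

lemma sign_vectors_mult_permuted:
  assumes "\<delta> \<in> sign_vectors" "\<eta> \<in> sign_vectors"
  shows "(\<chi> i. \<delta> $ i * \<eta> $ \<pi> i) \<in> sign_vectors"
proof -
  have "\<delta> $ i * \<eta> $ \<pi> i \<in> {-1, 1}" for i
    using assms by (auto simp: sign_vectors_def dest!: spec[of _ i] spec[of _ "\<pi> i"])
  then show ?thesis
    by (simp add: sign_vectors_def)
qed

lemma finite_sign_vectors: "finite (sign_vectors :: (real^'n) set)"
proof -
  have "sign_vectors \<subseteq> (\<lambda>f::'n \<Rightarrow> real. \<chi> i. f i) ` (UNIV \<rightarrow>\<^sub>E {-1, 1})"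
    by (force simp: sign_vectors_def vec_eq_iff image_iff PiE_def intro: bexI[of _ "vec_nth _"])
  then show ?thesis
    using finite_subset by (fastforce intro: finite_PiE)
qed

lemma ones_in_sign_vectors: "(\<chi> i. 1) \<in> sign_vectors"
  by (simp add: sign_vectors_def)

lemma signed_sum_le_max_sq_norm:
  "\<delta> \<in> sign_vectors \<Longrightarrow> (norm (signed_sum v \<delta>))\<^sup>2 \<le> max_sq_norm v"
  unfolding max_sq_norm_def signed_sum_def
  by (intro Max_ge finite_imageI finite_sign_vectors) blast

lemma max_sq_norm_attained:
  obtains \<delta> where "\<delta> \<in> sign_vectors" "max_sq_norm v = (norm (signed_sum v \<delta>))\<^sup>2"
proof -
  have "max_sq_norm v \<in> (\<lambda>\<delta>::real^4. (norm (signed_sum v \<delta>))\<^sup>2) ` sign_vectors"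
    unfolding max_sq_norm_def signed_sum_def
    using finite_sign_vectors ones_in_sign_vectors by (intro Max_in) auto
  then show ?thesis
    using that by blast
qed

lemma norm_signed_sum_le:
  assumes "\<delta> \<in> sign_vectors"
  shows "norm (signed_sum v \<delta>) \<le> (\<Sum>i\<in>UNIV. norm (v $ i))"
  unfolding signed_sum_def
  using norm_sum[of "\<lambda>i. \<delta> $ i *\<^sub>R v $ i" UNIV] by (simp add: sign_vectors_abs[OF assms])

lemma abs_diff_one_le_square: 
  fixes a :: real assumes "0 \<le> a" shows "\<bar>1 - a\<bar> \<le> \<bar>1 - a\<^sup>2\<bar>"
proof -
  have "1 - a\<^sup>2 = (1 - a) * (1 + a)"
    by (simp add: power2_eq_square algebra_simps)
  then have "\<bar>1 - a\<^sup>2\<bar> = \<bar>1 - a\<bar> * (1 + a)"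
    using assms by (simp add: abs_mult)
  then show ?thesis
    using assms mult_left_mono[of 1 "1 + a" "\<bar>1 - a\<bar>"] by simp
qed

section \<open>Second-order descent\<close>

definition normalize_rows :: "real^3^4 \<Rightarrow> real^3^4" where
  "normalize_rows u = (\<chi> i. u $ i /\<^sub>R norm (u $ i))"

text \<open>The second-order necessary condition for a minimum of a maximum of smooth functions on a product
  of spheres. Move along \<open>v + t w + t\<^sup>2 z\<close>: the hypotheses \<open>first\<close> and \<open>second\<close> keep every row of unit
  length up to \<open>O(t\<^sup>3)\<close>, so that normalizing the rows changes the signed sums only at that order. A
  choice of signs attaining the maximum changes at order \<open>t\<close> by a nonpositive amount and at order
  \<open>t\<^sup>2\<close> by a negative one; every other choice of signs stays below the maximum by continuity.\<close>

lemma second_order_descent: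
  fixes v w z :: "real^3^4"
  assumes v: "v \<in> configurations"
    and first: "\<And>i. v $ i \<bullet> w $ i = 0"
    and second: "\<And>i. 2 * (v $ i \<bullet> z $ i) + w $ i \<bullet> w $ i = 0"
    and active: "\<And>\<delta>. \<delta> \<in> sign_vectors \<Longrightarrow> (norm (signed_sum v \<delta>))\<^sup>2 = max_sq_norm v \<Longrightarrow>
        signed_sum v \<delta> \<bullet> signed_sum w \<delta> \<le> 0 \<and>
        signed_sum w \<delta> \<bullet> signed_sum w \<delta> + 2 * (signed_sum v \<delta> \<bullet> signed_sum z \<delta>) < 0"
  shows "\<not> attains_local_min_on configurations max_sq_norm v"
proof
  define u where "u t = v + t *\<^sub>R w + t\<^sup>2 *\<^sub>R z" for t :: real
  define n where "n t = normalize_rows (u t)" for t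
  let ?F = "at_right (0::real)"
  have norm_v: "norm (v $ i) = 1" for i
    using v by (simp add: configurations_def)
  have u_lim: "(u \<longlongrightarrow> v) ?F"
    unfolding u_def by (auto intro!: tendsto_eq_intros)
  have n_lim: "(n \<longlongrightarrow> v) ?F"
    unfolding n_def normalize_rows_def
  proof (rule vec_tendstoI)
    fix i
    show "((\<lambda>t. (\<chi> i. u t $ i /\<^sub>R norm (u t $ i)) $ i) \<longlongrightarrow> v $ i) ?F"
      using norm_v[of i]
      by (auto intro!: tendsto_eq_intros tendsto_vec_nth u_lim)
  qed
  have n_conf: "\<forall>\<^sub>F t in ?F. n t \<in> configurations"
  proof -
    have "\<forall>\<^sub>F t in ?F. u t $ i \<noteq> 0" for i
      using tendsto_imp_eventually_ne[OF tendsto_vec_nth[OF u_lim, of i], of 0] norm_v[of i] by fastforce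
    then have "\<forall>\<^sub>F t in ?F. \<forall>i\<in>UNIV. u t $ i \<noteq> 0"
      by (intro eventually_ball_finite) auto
    then show ?thesis
      by eventually_elim (auto simp: configurations_def n_def normalize_rows_def)
  qed
  have S_lim: "((\<lambda>t. signed_sum (f t) \<delta>) \<longlongrightarrow> signed_sum v \<delta>) ?F" if "(f \<longlongrightarrow> v) ?F" for f \<delta>
    unfolding signed_sum_def by (intro tendsto_intros tendsto_vec_nth that)
  have norm_u: "(norm (u t $ i))\<^sup>2 - 1 = t\<^sup>2 * (t * (2 * (w $ i \<bullet> z $ i)) + t\<^sup>2 * (z $ i \<bullet> z $ i))" for t i
  proof -
    have "(norm (u t $ i))\<^sup>2 = v $ i \<bullet> v $ i + 2 * t * (v $ i \<bullet> w $ i)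
        + t\<^sup>2 * (2 * (v $ i \<bullet> z $ i) + w $ i \<bullet> w $ i)
        + t\<^sup>2 * (t * (2 * (w $ i \<bullet> z $ i)) + t\<^sup>2 * (z $ i \<bullet> z $ i))"
      unfolding power2_norm_eq_inner u_def
      by (simp add: inner_add_left inner_add_right inner_commute algebra_simps power2_eq_square)
    moreover have "v $ i \<bullet> v $ i = 1"
      using norm_v[of i] by (simp add: norm_eq_1)
    ultimately show ?thesis
      using first[of i] second[of i] by simp
  qed
  have lower: "\<forall>\<^sub>F t in ?F. (norm (signed_sum (n t) \<delta>))\<^sup>2 < max_sq_norm v"
    if \<delta>: "\<delta> \<in> sign_vectors" for \<delta>
  proof (cases "(norm (signed_sum v \<delta>))\<^sup>2 = max_sq_norm v")
    case False
    then have "(norm (signed_sum v \<delta>))\<^sup>2 < max_sq_norm v"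
      using signed_sum_le_max_sq_norm[OF \<delta>, of v] by simp
    moreover have "((\<lambda>t. (norm (signed_sum (n t) \<delta>))\<^sup>2) \<longlongrightarrow> (norm (signed_sum v \<delta>))\<^sup>2) ?F"
      by (intro tendsto_intros S_lim n_lim)
    ultimately show ?thesis
      by (rule order_tendstoD(2)[rotated])
  next
    case True
    \<comment> \<open>The coefficients of the expansion in \<open>t\<close>, the remainder \<open>c\<close>, and a bound \<open>d\<close> for the effect of normalizing.\<close>
    define a where "a = signed_sum v \<delta> \<bullet> signed_sum w \<delta>"
    define b where "b = signed_sum w \<delta> \<bullet> signed_sum w \<delta> + 2 * (signed_sum v \<delta> \<bullet> signed_sum z \<delta>)"
    define c where "c t = t * (2 * (signed_sum w \<delta> \<bullet> signed_sum z \<delta>))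
      + t\<^sup>2 * (signed_sum z \<delta> \<bullet> signed_sum z \<delta>)" for t
    define d where "d t = (\<Sum>i\<in>UNIV. \<bar>t * (2 * (w $ i \<bullet> z $ i)) + t\<^sup>2 * (z $ i \<bullet> z $ i)\<bar>)
      * (norm (signed_sum (n t) \<delta>) + norm (signed_sum (u t) \<delta>))" for t
    have ab: "a \<le> 0" "b < 0"
      using active[OF \<delta> True] by (simp_all add: a_def b_def)
    have expand: "(norm (signed_sum (u t) \<delta>))\<^sup>2 = max_sq_norm v + 2 * t * a + t\<^sup>2 * b + t\<^sup>2 * c t" for t
      unfolding True[symmetric] power2_norm_eq_inner u_def a_def b_def c_def
        signed_sum_add signed_sum_scaleR
      by (simp add: inner_add_left inner_add_right inner_commute algebra_simps power2_eq_square)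
    have close: "(norm (signed_sum (n t) \<delta>))\<^sup>2 - (norm (signed_sum (u t) \<delta>))\<^sup>2 \<le> t\<^sup>2 * d t" for t
    proof -
      have "norm (signed_sum (n t) \<delta>) - norm (signed_sum (u t) \<delta>) \<le> norm (signed_sum (n t - u t) \<delta>)"
        by (simp add: signed_sum_diff norm_triangle_ineq2)
      also have "\<dots> \<le> (\<Sum>i\<in>UNIV. norm ((n t - u t) $ i))"
        by (rule norm_signed_sum_le[OF \<delta>])
      also have "\<dots> \<le> (\<Sum>i\<in>UNIV. \<bar>1 - (norm (u t $ i))\<^sup>2\<bar>)"
      proof (rule sum_mono)
        fix i
        have "norm ((n t - u t) $ i) \<le> \<bar>1 - norm (u t $ i)\<bar>"
        proof (cases "u t $ i = 0")
          case True
          then show ?thesis by (simp add: n_def normalize_rows_def)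
        next
          case False
          have "(n t - u t) $ i = (inverse (norm (u t $ i)) - 1) *\<^sub>R u t $ i"
            by (simp add: n_def normalize_rows_def algebra_simps)
          then have "norm ((n t - u t) $ i) = \<bar>inverse (norm (u t $ i)) - 1\<bar> * \<bar>norm (u t $ i)\<bar>"
            by simp
          also have "\<dots> = \<bar>1 - norm (u t $ i)\<bar>"
            unfolding abs_mult[symmetric] using False by (simp add: algebra_simps)
          finally show ?thesis by simp
        qed
        then show "norm ((n t - u t) $ i) \<le> \<bar>1 - (norm (u t $ i))\<^sup>2\<bar>"
          using abs_diff_one_le_square[of "norm (u t $ i)"] by simp
      qed
      also have "\<dots> = (\<Sum>i\<in>UNIV. t\<^sup>2 * \<bar>t * (2 * (w $ i \<bullet> z $ i)) + t\<^sup>2 * (z $ i \<bullet> z $ i)\<bar>)"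
        by (rule sum.cong) (simp_all add: abs_minus_commute[of 1] norm_u abs_mult)
      finally have "norm (signed_sum (n t) \<delta>) - norm (signed_sum (u t) \<delta>)
        \<le> t\<^sup>2 * (\<Sum>i\<in>UNIV. \<bar>t * (2 * (w $ i \<bullet> z $ i)) + t\<^sup>2 * (z $ i \<bullet> z $ i)\<bar>)"
        by (simp add: sum_distrib_left)
      from mult_right_mono[OF this, of "norm (signed_sum (n t) \<delta>) + norm (signed_sum (u t) \<delta>)"]
      show ?thesis
        by (simp add: d_def algebra_simps power2_eq_square)
    qed
    have "(d \<longlongrightarrow> 0 * (norm (signed_sum v \<delta>) + norm (signed_sum v \<delta>))) ?F"
      unfolding d_def by (rule tendsto_mult) (auto intro!: tendsto_eq_intros S_lim n_lim u_lim)
    moreover have "(c \<longlongrightarrow> 0) ?F"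
      unfolding c_def by (auto intro!: tendsto_eq_intros)
    ultimately have "((\<lambda>t. b + c t + d t) \<longlongrightarrow> b + 0 + 0) ?F"
      by (intro tendsto_intros) auto
    then have "\<forall>\<^sub>F t in ?F. b + c t + d t < 0"
      using ab by (intro order_tendstoD(2)) auto
    moreover have "\<forall>\<^sub>F t in ?F. (0::real) < t"
      by (simp add: eventually_at_right_less)
    ultimately show ?thesis
    proof eventually_elim
      case (elim t)
      have "(norm (signed_sum (n t) \<delta>))\<^sup>2 \<le> max_sq_norm v + 2 * t * a + t\<^sup>2 * (b + c t + d t)"
        using close[of t] expand[of t] by (simp add: algebra_simps)
      moreover have "t * a \<le> 0" "t\<^sup>2 * (b + c t + d t) < 0"
        using elim ab by (simp_all add: mult_pos_neg mult_nonneg_nonpos)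
      ultimately show ?case by simp
    qed
  qed
  assume "attains_local_min_on configurations max_sq_norm v"
  then obtain T where T: "open T" "v \<in> T"
    and min: "\<And>y. y \<in> configurations \<Longrightarrow> y \<in> T \<Longrightarrow> max_sq_norm v \<le> max_sq_norm y"
    unfolding attains_local_min_on_def openin_open by blast
  have "\<forall>\<^sub>F t in ?F. \<forall>\<delta>\<in>sign_vectors. (norm (signed_sum (n t) \<delta>))\<^sup>2 < max_sq_norm v"
    using lower by (intro eventually_ball_finite finite_sign_vectors) auto
  moreover have "\<forall>\<^sub>F t in ?F. n t \<in> T"
    using n_lim T by (rule topological_tendstoD)
  ultimately have "\<forall>\<^sub>F t in ?F. False"
    using n_conf
  proof eventually_elim
    case (elim t)
    obtain \<delta> where "\<delta> \<in> sign_vectors" "max_sq_norm (n t) = (norm (signed_sum (n t) \<delta>))\<^sup>2"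
      by (rule max_sq_norm_attained)
    then show ?case
      using elim min[of "n t"] by fastforce
  qed
  then show False by simp
qed

section \<open>Prescribed variations of the Gram matrix\<close>

text \<open>Four vectors spanning \<open>\<real>\<^sup>3\<close> have one linear dependency \<open>c\<close> up to scaling, and the map
  \<open>y \<mapsto> (y \<bullet> v\<^sub>i)\<^sub>i\<close> is injective with image contained in the hyperplane orthogonal to \<open>c\<close>, hence equal
  to it by dimension.\<close>

lemma dependency_of_spanning_configuration:
  fixes v :: "real^3^4"
  assumes span: "span (range (($) v)) = UNIV"
  obtains c :: "real^4" where "norm c = 1" "(\<Sum>i\<in>UNIV. c $ i *\<^sub>R v $ i) = 0"
    "\<forall>x. c \<bullet> x = 0 \<longrightarrow> (\<exists>y. \<forall>i. y \<bullet> v $ i = x $ i)"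
proof -
  define L :: "real^3 \<Rightarrow> real^4" where "L y = (\<chi> i. y \<bullet> v $ i)" for y
  have lin: "linear L"
    unfolding L_def by (intro linearI) (auto simp: vec_eq_iff inner_add_left)
  have inj: "inj L"
  proof (subst linear_injective_0[OF lin], safe)
    fix y assume "L y = 0"
    then have y0: "y \<bullet> v $ i = 0" for i
      by (simp add: L_def vec_eq_iff)
    have "orthogonal y x" if "x \<in> span (range (($) v))" for x
      by (rule orthogonal_to_span[OF that]) (auto simp: orthogonal_def y0)
    then show "y = 0"
      using span orthogonal_self[of y] by auto
  qed
  have sub: "subspace (range L)"
    using lin by (simp add: linear_subspace_image)
  have dim: "dim (range L) = 3"
    using dim_image_eq[OF lin, of UNIV] inj by simp
  obtain c0 where c0: "c0 \<noteq> 0" "\<And>y. y \<in> span (range L) \<Longrightarrow> orthogonal c0 y"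
    using orthogonal_to_subspace_exists[of "range L"] dim by auto
  define c where "c = c0 /\<^sub>R norm c0"
  have c: "norm c = 1" "c \<bullet> L y = 0" for y
    using c0(1) c0(2)[of "L y"] by (auto simp: c_def orthogonal_def span_base)
  have "range L = {x. c \<bullet> x = 0}"
  proof (rule subspace_dim_equal)
    show "subspace {x. c \<bullet> x = 0}"
      by (rule subspace_hyperplane)
    have "c \<noteq> 0" using c(1) by auto
    then show "dim {x. c \<bullet> x = 0} \<le> dim (range L)"
      using dim_hyperplane[of c] dim by simp
  qed (use sub c in auto)
  moreover have "(\<Sum>i\<in>UNIV. c $ i *\<^sub>R v $ i) = 0"
  proof -
    have "y \<bullet> (\<Sum>i\<in>UNIV. c $ i *\<^sub>R v $ i) = c \<bullet> L y" for y
      unfolding inner_sum_right L_def inner_vec_def[of c] by simp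
    then show ?thesis
      using c(2) by (metis inner_eq_zero_iff)
  qed
  moreover have "\<exists>y. \<forall>i. y \<bullet> v $ i = x $ i" if "x \<in> range L" for x
    using that by (auto simp: L_def)
  ultimately show ?thesis
    using that c(1) by blast
qed

text \<open>The tangent space of the Gram matrices of rank 3 at the Gram matrix of \<open>v\<close> consists of the
  symmetric matrices \<open>B\<close> with \<open>c\<^sup>T B c = 0\<close>. To realize such a \<open>B\<close> one needs a matrix \<open>X\<close> with
  \<open>X + X\<^sup>T = B\<close> whose rows are orthogonal to \<open>c\<close>. Adding to \<open>B / 2\<close> the antisymmetric matrix
  \<open>(c b\<^sup>T - b c\<^sup>T) / 2\<close> with \<open>b = B c\<close> achieves this, because \<open>c \<bullet> b = 0\<close>.\<close>

lemma prescribed_gram_variation: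
  fixes v :: "real^3^4" and c :: "real^4" and B :: "4 \<Rightarrow> 4 \<Rightarrow> real"
  assumes c: "norm c = 1"
    and range: "\<forall>x. c \<bullet> x = 0 \<longrightarrow> (\<exists>y. \<forall>i. y \<bullet> v $ i = x $ i)"
    and sym: "\<And>i j. B i j = B j i"
    and tangent: "(\<Sum>i\<in>UNIV. \<Sum>j\<in>UNIV. c $ i * c $ j * B i j) = 0"
  shows "\<exists>w :: real^3^4. \<forall>i j. v $ i \<bullet> w $ j + w $ i \<bullet> v $ j = B i j"
proof -
  define b where "b i = (\<Sum>j\<in>UNIV. c $ j * B i j)" for i
  define X where "X i = (\<chi> j. (B i j - b i * c $ j + c $ i * b j) / 2)" for i
  have cc: "(\<Sum>j\<in>UNIV. c $ j * c $ j) = 1"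
    using c by (simp add: norm_eq_1 inner_vec_def)
  have cb: "(\<Sum>j\<in>UNIV. c $ j * b j) = 0"
    using tangent by (simp add: b_def sum_distrib_left mult.assoc)
  have "c \<bullet> X i = 0" for i
  proof -
    have "c \<bullet> X i = (b i - b i * (\<Sum>j\<in>UNIV. c $ j * c $ j) + c $ i * (\<Sum>j\<in>UNIV. c $ j * b j)) / 2"
      by (simp add: inner_vec_def X_def b_def[of i] sum_distrib_left sum_divide_distrib
          algebra_simps sum.distrib sum_subtractf add_divide_distrib diff_divide_distrib)
    then show ?thesis
      by (simp add: cc cb)
  qed
  then have "\<forall>i. \<exists>y. \<forall>j. y \<bullet> v $ j = X i $ j"
    using range by blast
  then obtain y where y: "\<And>i j. y i \<bullet> v $ j = X i $ j"
    by metis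
  have "v $ i \<bullet> (\<chi> i. y i) $ j + (\<chi> i. y i) $ i \<bullet> v $ j = B i j" for i j
    using y[of i j] y[of j i] sym[of i j] by (simp add: inner_commute[of "v $ i"] X_def field_simps)
  then show ?thesis
    by blast
qed

lemma inner_signed_sum:
  "signed_sum v \<delta> \<bullet> signed_sum w \<delta> = (\<Sum>i\<in>UNIV. \<Sum>j\<in>UNIV. \<delta> $ i * \<delta> $ j * (v $ i \<bullet> w $ j))"
  unfolding signed_sum_def inner_sum_left
  by (simp add: inner_sum_right sum_distrib_left mult.assoc mult.left_commute)

lemma double_inner_signed_sum:
  "2 * (signed_sum v \<delta> \<bullet> signed_sum w \<delta>) =
    (\<Sum>i\<in>UNIV. \<Sum>j\<in>UNIV. \<delta> $ i * \<delta> $ j * (v $ i \<bullet> w $ j + w $ i \<bullet> v $ j))"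
  using inner_signed_sum[of v \<delta> w] inner_signed_sum[of w \<delta> v]
  by (simp add: inner_commute[of "signed_sum w \<delta>"] distrib_left sum.distrib)

lemma quadratic_form_rank_one:
  fixes x y :: "real^'n"
  shows "(\<Sum>i\<in>UNIV. \<Sum>j\<in>UNIV. x $ i * x $ j * (y $ i * y $ j)) = (x \<bullet> y)\<^sup>2"
  by (simp add: inner_vec_def power2_eq_square sum_product algebra_simps)

lemma quadratic_form_identity:
  fixes x :: "real^'n"
  shows "(\<Sum>i\<in>UNIV. \<Sum>j\<in>UNIV. x $ i * x $ j * of_bool (i = j)) = x \<bullet> x"
  by (simp add: inner_vec_def of_bool_def if_distrib cong: if_cong)

lemma sign_vector_inner_self: "\<delta> \<in> sign_vectors \<Longrightarrow> \<delta> \<bullet> \<delta> = real CARD('n)" for \<delta> :: "real^'n"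
  by (simp add: inner_vec_def sign_vectors_sq)

section \<open>Sums over sign vectors\<close>

lemma sum_of_signs_sq_le:
  fixes p1 p2 p3 p4 q1 q2 q3 q4 :: real
  assumes "{p1, p2, p3, p4} \<subseteq> {-1, 1}" "{q1, q2, q3, q4} \<subseteq> {-1, 1}"
    and "q1 + q2 + q3 + q4 = 0" "\<bar>p1 + p2 + p3 + p4\<bar> \<noteq> 4"
  shows "(p1 + p2 + p3 + p4)\<^sup>2 \<le> (p1 * q1 + p2 * q2 + p3 * q3 + p4 * q4)\<^sup>2"
proof -
  have "q1 = 1 \<or> q1 = -1" "q2 = 1 \<or> q2 = -1" "q3 = 1 \<or> q3 = -1" "q4 = 1 \<or> q4 = -1"
    using assms(2) by auto
  then consider "q1 = 1 \<and> q2 = 1 \<and> q3 = -1 \<and> q4 = -1" | "q1 = 1 \<and> q2 = -1 \<and> q3 = 1 \<and> q4 = -1"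
    | "q1 = 1 \<and> q2 = -1 \<and> q3 = -1 \<and> q4 = 1" | "q1 = -1 \<and> q2 = 1 \<and> q3 = 1 \<and> q4 = -1"
    | "q1 = -1 \<and> q2 = 1 \<and> q3 = -1 \<and> q4 = 1" | "q1 = -1 \<and> q2 = -1 \<and> q3 = 1 \<and> q4 = 1"
    using assms(3) by (elim disjE) simp_all
  moreover have "p1 = 1 \<or> p1 = -1" "p2 = 1 \<or> p2 = -1" "p3 = 1 \<or> p3 = -1" "p4 = 1 \<or> p4 = -1"
    using assms(1) by auto
  ultimately show ?thesis
    using assms(4) by cases (elim disjE; simp)+
qed

text \<open>If \<open>\<eta>\<close> has the parity of \<open>\<epsilon>\<close> and differs from \<open>\<plusminus>\<epsilon>\<close>, then \<open>\<eta> \<bullet> \<epsilon> = 0\<close>; if the parity is opposite,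
  both inner products are \<open>\<plusminus>2\<close>. So adding a positive multiple of \<open>\<epsilon>\<epsilon>\<^sup>T - \<delta>\<delta>\<^sup>T\<close> to a Gram matrix
  lengthens no signed sum other than those for \<open>\<plusminus>\<epsilon>\<close>.\<close>

lemma sign_vector_inner_sq_le:
  fixes \<delta> \<epsilon> \<eta> :: "real^4"
  assumes "\<delta> \<in> sign_vectors" "\<epsilon> \<in> sign_vectors" "\<eta> \<in> sign_vectors"
    and "\<epsilon> \<bullet> \<delta> = 0" "\<eta> \<noteq> \<epsilon>" "\<eta> \<noteq> - \<epsilon>"
  shows "(\<eta> \<bullet> \<epsilon>)\<^sup>2 \<le> (\<eta> \<bullet> \<delta>)\<^sup>2"
proof -
  define p where "p i = \<eta> $ i * \<epsilon> $ i" for i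
  define q where "q i = \<epsilon> $ i * \<delta> $ i" for i
  have p: "p i = 1 \<or> p i = -1" and q: "q i = 1 \<or> q i = -1" for i
    using assms(1-3) by (auto simp: p_def q_def sign_vectors_def dest!: spec[of _ i])
  have q0: "q 1 + q 2 + q 3 + q 4 = 0"
    using assms(4) by (simp add: q_def inner_vec_def sum_4)
  have eq: "\<eta> $ i = p i * \<epsilon> $ i" "\<delta> $ i = q i * \<epsilon> $ i" for i
    using sign_vectors_sq[OF assms(2), of i] by (simp_all add: p_def q_def)
  have "\<not> (\<forall>i. p i = 1)" "\<not> (\<forall>i. p i = -1)"
    using assms(5,6) eq(1) by (metis mult_1 vec_eq_iff, metis mult_minus1 vec_eq_iff vector_uminus_component)
  then have "\<bar>p 1 + p 2 + p 3 + p 4\<bar> \<noteq> 4"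
    using p[of 1] p[of 2] p[of 3] p[of 4] by (auto simp: forall_4)
  moreover have "\<eta> \<bullet> \<epsilon> = p 1 + p 2 + p 3 + p 4"
    by (simp add: p_def inner_vec_def sum_4)
  moreover have "\<eta> \<bullet> \<delta> = (\<Sum>i\<in>UNIV. p i * q i)"
    unfolding inner_vec_def
    by (rule sum.cong) (use sign_vectors_sq[OF assms(2)] in \<open>simp_all add: eq algebra_simps\<close>)
  then have "\<eta> \<bullet> \<delta> = p 1 * q 1 + p 2 * q 2 + p 3 * q 3 + p 4 * q 4"
    by (simp add: sum_4)
  ultimately show ?thesis
    using sum_of_signs_sq_le[of "p 1" "p 2" "p 3" "p 4" "q 1" "q 2" "q 3" "q 4"] p q q0 by auto
qed

lemma norm_signed_sum_sq:
  assumes v: "v \<in> configurations" and \<delta>: "\<delta> \<in> sign_vectors"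
  shows "(norm (signed_sum v \<delta>))\<^sup>2 = 4 + 2 * (\<delta> $ 1 * \<delta> $ 2 * (v $ 1 \<bullet> v $ 2)
    + \<delta> $ 1 * \<delta> $ 3 * (v $ 1 \<bullet> v $ 3) + \<delta> $ 1 * \<delta> $ 4 * (v $ 1 \<bullet> v $ 4)
    + \<delta> $ 2 * \<delta> $ 3 * (v $ 2 \<bullet> v $ 3) + \<delta> $ 2 * \<delta> $ 4 * (v $ 2 \<bullet> v $ 4)
    + \<delta> $ 3 * \<delta> $ 4 * (v $ 3 \<bullet> v $ 4))"
proof -
  have "v $ i \<bullet> v $ i = 1" for i
    using v by (auto simp: configurations_def norm_eq_1)
  then show ?thesis
    unfolding power2_norm_eq_inner inner_signed_sum
    using sign_vectors_sq[OF \<delta>]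
    by (simp add: sum_4 inner_commute[of "v $ 2" "v $ 1"] inner_commute[of "v $ 3" "v $ 1"]
        inner_commute[of "v $ 3" "v $ 2"] inner_commute[of "v $ 4" "v $ 1"]
        inner_commute[of "v $ 4" "v $ 2"] inner_commute[of "v $ 4" "v $ 3"] algebra_simps)
qed

definition signs :: "real \<Rightarrow> real \<Rightarrow> real \<Rightarrow> real \<Rightarrow> real^4" where
  "signs a b c d = (\<chi> i. if i = 1 then a else if i = 2 then b else if i = 3 then c else d)"

lemma signs_nth [simp]:
  "signs a b c d $ 1 = a" "signs a b c d $ 2 = b" "signs a b c d $ 3 = c" "signs a b c d $ 4 = d"
  by (simp_all add: signs_def)

lemma signs_in_sign_vectors [simp]:
  "signs a b c d \<in> sign_vectors \<longleftrightarrow> {a, b, c, d} \<subseteq> {-1, 1}"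
  by (auto simp: sign_vectors_def forall_4)

text \<open>The eight values average to \<open>4\<close>. A maximum of \<open>4\<close> would force all of them to be equal, which
  makes the four vectors orthonormal and contradicts their dependency.\<close>

lemma max_sq_norm_gt_4:
  assumes v: "v \<in> configurations" and c: "c \<noteq> 0" "(\<Sum>i\<in>UNIV. c $ i *\<^sub>R v $ i) = 0"
  shows "4 < max_sq_norm v"
proof (rule ccontr)
  assume "\<not> 4 < max_sq_norm v"
  then have le: "(norm (signed_sum v \<delta>))\<^sup>2 \<le> 4" if "\<delta> \<in> sign_vectors" for \<delta>
    using signed_sum_le_max_sq_norm[OF that, of v] by simp
  have "a * b * (v $ 1 \<bullet> v $ 2) + a * c * (v $ 1 \<bullet> v $ 3) + a * d * (v $ 1 \<bullet> v $ 4)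
    + b * c * (v $ 2 \<bullet> v $ 3) + b * d * (v $ 2 \<bullet> v $ 4) + c * d * (v $ 3 \<bullet> v $ 4) \<le> 0"
    if "{a, b, c, d} \<subseteq> {-1, 1}" for a b c d
    using le[of "signs a b c d"] norm_signed_sum_sq[OF v, of "signs a b c d"] that by simp
  note q = this[of 1 1 1 1] this[of 1 1 "-1" "-1"] this[of 1 "-1" 1 "-1"] this[of 1 "-1" "-1" 1]
    this[of "-1" 1 1 1] this[of 1 "-1" 1 1] this[of 1 1 "-1" 1] this[of 1 1 1 "-1"]
  have orth: "v $ 1 \<bullet> v $ 2 = 0" "v $ 1 \<bullet> v $ 3 = 0" "v $ 1 \<bullet> v $ 4 = 0"
    "v $ 2 \<bullet> v $ 3 = 0" "v $ 2 \<bullet> v $ 4 = 0" "v $ 3 \<bullet> v $ 4 = 0"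
    using q[simplified] by linarith+
  have unit: "v $ i \<bullet> v $ i = 1" for i
    using v by (auto simp: configurations_def norm_eq_1)
  have "v $ j \<bullet> (\<Sum>i\<in>UNIV. c $ i *\<^sub>R v $ i) = 0" for j
    using c(2) by simp
  note z = this[of 1] this[of 2] this[of 3] this[of 4]
  have "c $ 1 = 0" "c $ 2 = 0" "c $ 3 = 0" "c $ 4 = 0"
    using z orth unit by (simp_all add: sum_4 inner_add_right inner_commute)
  then have "c = 0"
    by (simp add: vec_eq_iff forall_4)
  with c(1) show False by simp
qed

section \<open>Inactive sign vectors at a local minimum\<close>

text \<open>Call a sign vector inactive if its signed sum is shorter than the maximum. The Gram matrix \<open>G\<close> is
  varied in the direction \<open>A = \<epsilon>\<epsilon>\<^sup>T - \<delta>\<delta>\<^sup>T\<close>, which has zero diagonal, increases no active value, and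
  satisfies \<open>c\<^sup>T A c = (c \<bullet> \<epsilon>)\<^sup>2 - (c \<bullet> \<delta>)\<^sup>2\<close>. A variation that leaves the cone of positive semidefinite
  matrices is brought back by shrinking the off-diagonal part \<open>N = G - I\<close>; since the maximum exceeds
  \<open>4\<close>, this strictly decreases the active values.

  If \<open>c\<^sup>T A c < 0\<close>, the correction has the order of the variation itself. If \<open>c\<^sup>T A c = 0\<close>, then \<open>A\<close> is
  tangent to the matrices of rank 3, and \<open>A c = (c \<bullet> \<epsilon>) \<epsilon> - (c \<bullet> \<delta>) \<delta>\<close> is not zero unless
  \<open>c \<bullet> \<delta> = 0\<close>. Then the boundary of the cone curves away from the line \<open>G + t A\<close>, and the correction
  is a positive multiple of \<open>t\<^sup>2 N\<close>.\<close>

lemma no_descent_direction: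
  fixes v :: "real^3^4" and c \<delta> \<epsilon> :: "real^4"
  assumes v: "v \<in> configurations"
    and min: "attains_local_min_on configurations max_sq_norm v"
    and c: "norm c = 1" and dep: "(\<Sum>i\<in>UNIV. c $ i *\<^sub>R v $ i) = 0"
    and range: "\<forall>x. c \<bullet> x = 0 \<longrightarrow> (\<exists>y. \<forall>i. y \<bullet> v $ i = x $ i)"
    and \<epsilon>: "\<epsilon> \<in> sign_vectors" "(norm (signed_sum v \<epsilon>))\<^sup>2 < max_sq_norm v"
    and \<delta>: "\<delta> \<in> sign_vectors" "\<epsilon> \<bullet> \<delta> = 0"
    and le: "\<bar>c \<bullet> \<epsilon>\<bar> \<le> \<bar>c \<bullet> \<delta>\<bar>"
  shows "c \<bullet> \<delta> = 0"
proof (rule ccontr)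
  assume nz: "c \<bullet> \<delta> \<noteq> 0"
  define A where "A i j = \<epsilon> $ i * \<epsilon> $ j - \<delta> $ i * \<delta> $ j" for i j
  define N where "N i j = v $ i \<bullet> v $ j - of_bool (i = j)" for i j
  have unit: "v $ i \<bullet> v $ i = 1" for i
    using v by (auto simp: configurations_def norm_eq_1)
  have diag: "A i i = 0" "N i i = 0" for i
    using \<epsilon>(1) \<delta>(1) by (simp_all add: A_def N_def sign_vectors_sq unit)
  have sym: "A i j = A j i" "N i j = N j i" for i j
    by (simp_all add: A_def N_def inner_commute eq_commute mult.commute)
  have quad_A: "(\<Sum>i\<in>UNIV. \<Sum>j\<in>UNIV. x $ i * x $ j * A i j) = (x \<bullet> \<epsilon>)\<^sup>2 - (x \<bullet> \<delta>)\<^sup>2" for x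
    unfolding quadratic_form_rank_one[symmetric] by (simp add: A_def right_diff_distrib sum_subtractf)
  have quad_N: "(\<Sum>i\<in>UNIV. \<Sum>j\<in>UNIV. x $ i * x $ j * N i j)
      = (norm (signed_sum v x))\<^sup>2 - x \<bullet> x" for x
    unfolding quadratic_form_identity[of x, symmetric] power2_norm_eq_inner inner_signed_sum
    by (simp add: N_def right_diff_distrib sum_subtractf)
  have "signed_sum v c = 0"
    using dep by (simp add: signed_sum_def)
  then have c_N: "(\<Sum>i\<in>UNIV. \<Sum>j\<in>UNIV. c $ i * c $ j * N i j) = - 1"
    using c unfolding quad_N by (simp add: norm_eq_1)
  have gt4: "4 < max_sq_norm v"
    using v c dep by (intro max_sq_norm_gt_4) auto
  have active_A: "(\<eta> \<bullet> \<epsilon>)\<^sup>2 - (\<eta> \<bullet> \<delta>)\<^sup>2 \<le> 0"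
    if "\<eta> \<in> sign_vectors" "(norm (signed_sum v \<eta>))\<^sup>2 = max_sq_norm v" for \<eta>
  proof -
    have "signed_sum v (- \<epsilon>) = - signed_sum v \<epsilon>"
      by (simp add: signed_sum_def sum_negf)
    then have "\<eta> \<noteq> \<epsilon>" "\<eta> \<noteq> - \<epsilon>"
      using that \<epsilon>(2) by auto
    then show ?thesis
      using sign_vector_inner_sq_le[OF \<delta>(1) \<epsilon>(1) that(1) \<delta>(2)] by simp
  qed
  have active_N: "(norm (signed_sum v \<eta>))\<^sup>2 - \<eta> \<bullet> \<eta> = max_sq_norm v - 4"
    if "\<eta> \<in> sign_vectors" "(norm (signed_sum v \<eta>))\<^sup>2 = max_sq_norm v" for \<eta>
    using that by (simp add: sign_vector_inner_self)
  show False
  proof (cases "\<bar>c \<bullet> \<epsilon>\<bar> = \<bar>c \<bullet> \<delta>\<bar>")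
    case True
    then have eq: "(c \<bullet> \<epsilon>)\<^sup>2 = (c \<bullet> \<delta>)\<^sup>2"
      by (simp add: power2_eq_iff abs_eq_iff)
    have tangent_A: "(\<Sum>i\<in>UNIV. \<Sum>j\<in>UNIV. c $ i * c $ j * A i j) = 0"
      by (simp add: quad_A eq)
    obtain w where w: "\<And>i j. v $ i \<bullet> w $ j + w $ i \<bullet> v $ j = A i j"
      using prescribed_gram_variation[OF c range sym(1) tangent_A] by blast
    \<comment> \<open>The Gram matrix of \<open>w\<close> enters at order \<open>t\<^sup>2\<close>; this factor of \<open>- N\<close> restores the tangency condition.\<close>
    define k where "k = signed_sum w c \<bullet> signed_sum w c"
    have "signed_sum w c \<noteq> 0"
    proof
      assume 0: "signed_sum w c = 0"
      have "(c \<bullet> \<epsilon>) * \<epsilon> $ j - (c \<bullet> \<delta>) * \<delta> $ j = 0" for j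
      proof -
        have "(c \<bullet> \<epsilon>) * \<epsilon> $ j - (c \<bullet> \<delta>) * \<delta> $ j = (\<Sum>i\<in>UNIV. c $ i * A i j)"
          by (simp add: A_def inner_vec_def sum_distrib_right right_diff_distrib sum_subtractf mult.assoc)
        also have "\<dots> = signed_sum v c \<bullet> w $ j + signed_sum w c \<bullet> v $ j"
          by (simp add: w[symmetric] signed_sum_def inner_sum_left distrib_left sum.distrib)
        finally show ?thesis
          using 0 \<open>signed_sum v c = 0\<close> by simp
      qed
      then have "(c \<bullet> \<epsilon>) *\<^sub>R \<epsilon> - (c \<bullet> \<delta>) *\<^sub>R \<delta> = 0"
        by (simp add: vec_eq_iff)
      then have "((c \<bullet> \<epsilon>) *\<^sub>R \<epsilon> - (c \<bullet> \<delta>) *\<^sub>R \<delta>) \<bullet> \<delta> = 0"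
        by simp
      then have "(c \<bullet> \<delta>) * 4 = 0"
        using \<delta> by (simp add: inner_diff_left sign_vector_inner_self)
      then show False
        using nz by simp
    qed
    then have k: "0 < k"
      by (simp add: k_def)
    define B where "B i j = - k * N i j - w $ i \<bullet> w $ j" for i j
    have "(\<Sum>i\<in>UNIV. \<Sum>j\<in>UNIV. x $ i * x $ j * B i j)
        = - k * ((norm (signed_sum v x))\<^sup>2 - x \<bullet> x) - signed_sum w x \<bullet> signed_sum w x" for x
      unfolding quad_N[symmetric] inner_signed_sum
      by (simp add: B_def right_diff_distrib sum_subtractf sum_distrib_left sum_negf algebra_simps)
    note quad_B = this
    have tangent_B: "(\<Sum>i\<in>UNIV. \<Sum>j\<in>UNIV. c $ i * c $ j * B i j) = 0"
      unfolding quad_B using c_N quad_N[of c] by (simp add: k_def)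
    have sym_B: "B i j = B j i" for i j
      using sym(2) by (simp add: B_def inner_commute)
    obtain z where z: "\<And>i j. v $ i \<bullet> z $ j + z $ i \<bullet> v $ j = B i j"
      using prescribed_gram_variation[OF c range sym_B tangent_B] by blast
    have "\<not> attains_local_min_on configurations max_sq_norm v"
    proof (rule second_order_descent[OF v, of w z])
      show "v $ i \<bullet> w $ i = 0" for i
        using w[of i i] diag by (simp add: inner_commute)
      show "2 * (v $ i \<bullet> z $ i) + w $ i \<bullet> w $ i = 0" for i
        using z[of i i] diag by (simp add: inner_commute B_def)
      fix \<eta> :: "real^4" assume \<eta>: "\<eta> \<in> sign_vectors" "(norm (signed_sum v \<eta>))\<^sup>2 = max_sq_norm v"
      have "2 * (signed_sum v \<eta> \<bullet> signed_sum w \<eta>) \<le> 0"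
        unfolding double_inner_signed_sum w quad_A by (rule active_A[OF \<eta>])
      moreover have "signed_sum w \<eta> \<bullet> signed_sum w \<eta> + 2 * (signed_sum v \<eta> \<bullet> signed_sum z \<eta>) < 0"
        unfolding double_inner_signed_sum z quad_B active_N[OF \<eta>] using k gt4 by simp
      ultimately show "signed_sum v \<eta> \<bullet> signed_sum w \<eta> \<le> 0 \<and>
          signed_sum w \<eta> \<bullet> signed_sum w \<eta> + 2 * (signed_sum v \<eta> \<bullet> signed_sum z \<eta>) < 0"
        by simp
    qed
    with min show False by contradiction
  next
    case False
    define k where "k = (c \<bullet> \<delta>)\<^sup>2 - (c \<bullet> \<epsilon>)\<^sup>2"
    have k: "0 < k"
      using le False abs_le_square_iff[of "c \<bullet> \<delta>" "c \<bullet> \<epsilon>"] by (simp add: k_def not_le[symmetric])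
    define B where "B i j = A i j - k * N i j" for i j
    have quad_B: "(\<Sum>i\<in>UNIV. \<Sum>j\<in>UNIV. x $ i * x $ j * B i j)
        = (x \<bullet> \<epsilon>)\<^sup>2 - (x \<bullet> \<delta>)\<^sup>2 - k * ((norm (signed_sum v x))\<^sup>2 - x \<bullet> x)" for x
      unfolding quad_N[symmetric] quad_A[symmetric]
      by (simp add: B_def right_diff_distrib sum_subtractf sum_distrib_left algebra_simps)
    have tangent_B: "(\<Sum>i\<in>UNIV. \<Sum>j\<in>UNIV. c $ i * c $ j * B i j) = 0"
      unfolding quad_B using c_N quad_N[of c] by (simp add: k_def)
    have sym_B: "B i j = B j i" for i j
      using sym by (simp add: B_def)
    obtain z where z: "\<And>i j. v $ i \<bullet> z $ j + z $ i \<bullet> v $ j = B i j"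
      using prescribed_gram_variation[OF c range sym_B tangent_B] by blast
    \<comment> \<open>Here the whole variation is put at order \<open>t\<^sup>2\<close>.\<close>
    have "\<not> attains_local_min_on configurations max_sq_norm v"
    proof (rule second_order_descent[OF v, of 0 z])
      show "2 * (v $ i \<bullet> z $ i) + 0 $ i \<bullet> (0 :: real^3^4) $ i = 0" for i
        using z[of i i] diag by (simp add: inner_commute B_def)
      fix \<eta> :: "real^4" assume \<eta>: "\<eta> \<in> sign_vectors" "(norm (signed_sum v \<eta>))\<^sup>2 = max_sq_norm v"
      have "2 * (signed_sum v \<eta> \<bullet> signed_sum z \<eta>) < 0"
        unfolding double_inner_signed_sum z quad_B active_N[OF \<eta>]
        using k gt4 active_A[OF \<eta>] by (smt (verit) mult_pos_pos)
      moreover have "signed_sum 0 \<eta> = 0"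
        by (simp add: signed_sum_def)
      ultimately show "signed_sum v \<eta> \<bullet> signed_sum 0 \<eta> \<le> 0 \<and>
          signed_sum 0 \<eta> \<bullet> signed_sum 0 \<eta> + 2 * (signed_sum v \<eta> \<bullet> signed_sum z \<eta>) < 0"
        by simp
    qed simp
    with min show False by contradiction
  qed
qed

text \<open>Suppose \<open>\<epsilon>\<close> and \<open>\<delta>\<close> are orthogonal and both inactive. Comparing them in both directions gives
  \<open>c \<bullet> \<epsilon> = c \<bullet> \<delta> = 0\<close>, and comparing \<open>\<epsilon>\<close> with every sign vector orthogonal to it shows that \<open>c\<close> is
  orthogonal to all of them as well. These vectors together with \<open>\<epsilon>\<close> span \<open>\<real>\<^sup>4\<close>, so \<open>c = 0\<close>.\<close>

lemma inactive_signs_isolated: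
  fixes v :: "real^3^4" and \<delta> \<epsilon> :: "real^4"
  assumes v: "v \<in> configurations" "span (range (($) v)) = UNIV"
    and min: "attains_local_min_on configurations max_sq_norm v"
    and \<epsilon>: "\<epsilon> \<in> sign_vectors" "(norm (signed_sum v \<epsilon>))\<^sup>2 < max_sq_norm v"
    and \<delta>: "\<delta> \<in> sign_vectors" "\<epsilon> \<bullet> \<delta> = 0"
  shows "(norm (signed_sum v \<delta>))\<^sup>2 = max_sq_norm v"
proof (rule ccontr)
  assume "(norm (signed_sum v \<delta>))\<^sup>2 \<noteq> max_sq_norm v"
  then have inactive: "(norm (signed_sum v \<delta>))\<^sup>2 < max_sq_norm v"
    using signed_sum_le_max_sq_norm[OF \<delta>(1), of v] by simp
  obtain c where c: "norm c = 1" "(\<Sum>i\<in>UNIV. c $ i *\<^sub>R v $ i) = 0"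
    "\<forall>x. c \<bullet> x = 0 \<longrightarrow> (\<exists>y. \<forall>i. y \<bullet> v $ i = x $ i)"
    by (rule dependency_of_spanning_configuration[OF v(2)])
  note key = no_descent_direction[OF v(1) min c]
  have \<epsilon>0: "c \<bullet> \<epsilon> = 0"
    using key[OF \<epsilon> \<delta>] key[OF \<delta>(1) inactive \<epsilon>(1)] \<delta>(2)
    by (metis abs_ge_zero abs_zero inner_commute linear)
  have perp: "c \<bullet> \<zeta> = 0" if "\<zeta> \<in> sign_vectors" "\<epsilon> \<bullet> \<zeta> = 0" for \<zeta>
    using key[OF \<epsilon> that] \<epsilon>0 by simp
  \<comment> \<open>Multiplying by \<open>\<epsilon>\<close> coordinatewise reduces to the case where all entries of \<open>\<epsilon>\<close> are 1.\<close>
  define d where "d i = c $ i * \<epsilon> $ i" for i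
  have balanced: "d 1 * p + d 2 * q + d 3 * r + d 4 * s = 0"
    if "{p, q, r, s} \<subseteq> {-1, 1}" "p + q + r + s = 0" for p q r s
  proof -
    define \<zeta> where "\<zeta> = signs (\<epsilon> $ 1 * p) (\<epsilon> $ 2 * q) (\<epsilon> $ 3 * r) (\<epsilon> $ 4 * s)"
    have "\<epsilon> $ i * x \<in> {-1, 1}" if "x \<in> {-1, 1}" for i x
      using \<epsilon>(1) that by (auto simp: sign_vectors_def dest!: spec[of _ i])
    then have "\<zeta> \<in> sign_vectors"
      using that(1) by (simp add: \<zeta>_def)
    moreover have "\<epsilon> \<bullet> \<zeta> = 0"
      using that(2)
      by (simp add: \<zeta>_def inner_vec_def sum_4 mult.assoc[symmetric] sign_vectors_sq[OF \<epsilon>(1)])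
    ultimately have "c \<bullet> \<zeta> = 0"
      by (rule perp)
    then show ?thesis
      by (simp add: \<zeta>_def d_def inner_vec_def sum_4 mult.assoc)
  qed
  have "d 1 + d 2 + d 3 + d 4 = 0"
    using \<epsilon>0 by (simp add: d_def inner_vec_def sum_4)
  then have "d 1 = 0 \<and> d 2 = 0 \<and> d 3 = 0 \<and> d 4 = 0"
    using balanced[of 1 1 "-1" "-1"] balanced[of 1 "-1" 1 "-1"] balanced[of 1 "-1" "-1" 1] by simp
  then have "\<forall>i. d i = 0"
    by (simp add: forall_4)
  moreover have "c $ i = d i * \<epsilon> $ i" for i
    using sign_vectors_sq[OF \<epsilon>(1), of i] by (simp add: d_def)
  ultimately have "c = 0"
    by (simp add: vec_eq_iff)
  with c(1) show False by simp
qed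

section \<open>Local minima are triangular pyramids\<close>

lemma ex_one_differing_sign:
  fixes f :: "4 \<Rightarrow> real"
  assumes "\<And>i. f i = 1 \<or> f i = -1" and "f 1 * f 2 * f 3 * f 4 = -1"
  shows "\<exists>m \<sigma>. (\<sigma> = 1 \<or> \<sigma> = -1) \<and> (\<forall>i. f i = (if i = m then - \<sigma> else \<sigma>))"
proof -
  have witness: ?thesis if "\<tau> = 1 \<or> \<tau> = -1" "\<forall>i. f i = (if i = k then - \<tau> else \<tau>)" for \<tau> k
    using that by blast
  consider "f 1 = -1 \<and> f 2 = 1 \<and> f 3 = 1 \<and> f 4 = 1" | "f 1 = 1 \<and> f 2 = -1 \<and> f 3 = 1 \<and> f 4 = 1"
    | "f 1 = 1 \<and> f 2 = 1 \<and> f 3 = -1 \<and> f 4 = 1" | "f 1 = 1 \<and> f 2 = 1 \<and> f 3 = 1 \<and> f 4 = -1"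
    | "f 1 = 1 \<and> f 2 = -1 \<and> f 3 = -1 \<and> f 4 = -1" | "f 1 = -1 \<and> f 2 = 1 \<and> f 3 = -1 \<and> f 4 = -1"
    | "f 1 = -1 \<and> f 2 = -1 \<and> f 3 = 1 \<and> f 4 = -1" | "f 1 = -1 \<and> f 2 = -1 \<and> f 3 = -1 \<and> f 4 = 1"
    using assms(1)[of 1] assms(1)[of 2] assms(1)[of 3] assms(1)[of 4] assms(2) by (elim disjE) simp_all
  then show ?thesis
  proof cases
    case 1 then show ?thesis by (intro witness[of 1 1]) (simp_all add: forall_4)
  next
    case 2 then show ?thesis by (intro witness[of 1 2]) (simp_all add: forall_4)
  next
    case 3 then show ?thesis by (intro witness[of 1 3]) (simp_all add: forall_4)
  next
    case 4 then show ?thesis by (intro witness[of 1 4]) (simp_all add: forall_4)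
  next
    case 5 then show ?thesis by (intro witness[of "-1" 1]) (simp_all add: forall_4)
  next
    case 6 then show ?thesis by (intro witness[of "-1" 2]) (simp_all add: forall_4)
  next
    case 7 then show ?thesis by (intro witness[of "-1" 3]) (simp_all add: forall_4)
  next
    case 8 then show ?thesis by (intro witness[of "-1" 4]) (simp_all add: forall_4)
  qed
qed

text \<open>Up to sign there are four choices of signs with a given product, namely the rows of a Hadamard
  matrix. Their values average to \<open>4\<close>, so they do not all attain the maximum.\<close>

lemma ex_inactive_signs_of_parity:
  fixes v :: "real^3^4" and \<sigma> :: real
  assumes v: "v \<in> configurations" and gt: "4 < max_sq_norm v" and \<sigma>: "\<sigma> = 1 \<or> \<sigma> = -1"
  obtains \<epsilon> where "\<epsilon> \<in> sign_vectors" "(norm (signed_sum v \<epsilon>))\<^sup>2 < max_sq_norm v"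
    "\<epsilon> $ 1 * \<epsilon> $ 2 * \<epsilon> $ 3 * \<epsilon> $ 4 = \<sigma>"
proof (rule ccontr)
  note result = that
  assume not: "\<not> thesis"
  have ge: "max_sq_norm v \<le> (norm (signed_sum v (signs \<sigma> b c d)))\<^sup>2"
    if "{b, c, d} \<subseteq> {-1, 1}" "b * c * d = 1" for b c d
  proof (rule ccontr)
    assume "\<not> max_sq_norm v \<le> (norm (signed_sum v (signs \<sigma> b c d)))\<^sup>2"
    moreover have "signs \<sigma> b c d \<in> sign_vectors"
      using \<sigma> that by auto
    moreover have "\<sigma> * b * c * d = \<sigma>"
      using that(2) by (metis mult.assoc mult.right_neutral)
    ultimately have thesis
      by (intro result[of "signs \<sigma> b c d"]) auto
    with not show False by contradiction
  qed
  have "signs \<sigma> b c d \<in> sign_vectors" if "{b, c, d} \<subseteq> {-1, 1}" for b c d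
    using that \<sigma> by auto
  note Q = norm_signed_sum_sq[OF v this]
  show False
    using gt ge[of 1 1 1] ge[of 1 "-1" "-1"] ge[of "-1" 1 "-1"] ge[of "-1" "-1" 1]
      Q[of 1 1 1] Q[of 1 "-1" "-1"] Q[of "-1" 1 "-1"] Q[of "-1" "-1" 1]
    by simp
qed

text \<open>There is an inactive \<open>\<epsilon>\<close> with product \<open>1\<close> and an inactive \<open>\<omega>\<close> with product \<open>-1\<close>. Up to sign they
  differ in exactly one index, and after changing signs and permuting it may be assumed that
  \<open>\<epsilon> = (1, 1, 1, 1)\<close> and \<open>\<omega> = (-1, 1, 1, 1)\<close>. The six remaining values are all equal to the maximum
  \<open>4 + 2 t\<close>. These are six linear equations for the six inner products; they make the first vector
  orthogonal to the others, whose mutual inner products are \<open>- t\<close>. The linear dependency of the vectors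
  then forces \<open>t = 1/2\<close>.\<close>

lemma local_min_gram:
  fixes v :: "real^3^4"
  assumes v: "v \<in> configurations" and span: "span (range (($) v)) = UNIV"
    and min: "attains_local_min_on configurations max_sq_norm v"
  obtains \<pi> \<delta> w where "bij \<pi>" "\<delta> \<in> sign_vectors" "w \<in> configurations"
    "\<And>i. w $ i = \<delta> $ i *\<^sub>R v $ \<pi> i"
    "w $ 1 \<bullet> w $ 2 = 0" "w $ 1 \<bullet> w $ 3 = 0" "w $ 1 \<bullet> w $ 4 = 0"
    "w $ 2 \<bullet> w $ 3 = -1/2" "w $ 2 \<bullet> w $ 4 = -1/2" "w $ 3 \<bullet> w $ 4 = -1/2"
proof -
  obtain c where c: "norm c = 1" "(\<Sum>i\<in>UNIV. c $ i *\<^sub>R v $ i) = 0"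
    "\<forall>x. c \<bullet> x = 0 \<longrightarrow> (\<exists>y. \<forall>i. y \<bullet> v $ i = x $ i)"
    by (rule dependency_of_spanning_configuration[OF span])
  have gt4: "4 < max_sq_norm v"
    using v c by (intro max_sq_norm_gt_4) auto
  obtain \<epsilon> where \<epsilon>: "\<epsilon> \<in> sign_vectors" "(norm (signed_sum v \<epsilon>))\<^sup>2 < max_sq_norm v"
    "\<epsilon> $ 1 * \<epsilon> $ 2 * \<epsilon> $ 3 * \<epsilon> $ 4 = 1"
    by (rule ex_inactive_signs_of_parity[OF v gt4 disjI1[OF refl]])
  obtain \<omega> where \<omega>: "\<omega> \<in> sign_vectors" "(norm (signed_sum v \<omega>))\<^sup>2 < max_sq_norm v"
    "\<omega> $ 1 * \<omega> $ 2 * \<omega> $ 3 * \<omega> $ 4 = -1"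
    by (rule ex_inactive_signs_of_parity[OF v gt4 disjI2[OF refl]])
  have "(\<epsilon> $ 1 * \<omega> $ 1) * (\<epsilon> $ 2 * \<omega> $ 2) * (\<epsilon> $ 3 * \<omega> $ 3) * (\<epsilon> $ 4 * \<omega> $ 4)
      = (\<epsilon> $ 1 * \<epsilon> $ 2 * \<epsilon> $ 3 * \<epsilon> $ 4) * (\<omega> $ 1 * \<omega> $ 2 * \<omega> $ 3 * \<omega> $ 4)"
    by (simp add: algebra_simps)
  then have prod: "(\<epsilon> $ 1 * \<omega> $ 1) * (\<epsilon> $ 2 * \<omega> $ 2) * (\<epsilon> $ 3 * \<omega> $ 3) * (\<epsilon> $ 4 * \<omega> $ 4) = -1"
    by (simp add: \<epsilon>(3) \<omega>(3))
  have pm: "\<epsilon> $ i * \<omega> $ i = 1 \<or> \<epsilon> $ i * \<omega> $ i = -1" for i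
    using \<epsilon>(1) \<omega>(1) by (auto simp: sign_vectors_def dest!: spec[of _ i])
  obtain m \<sigma> where m: "\<sigma> = 1 \<or> \<sigma> = -1"
      "\<And>i. \<epsilon> $ i * \<omega> $ i = (if i = m then - \<sigma> else \<sigma>)"
    using ex_one_differing_sign[of "\<lambda>i. \<epsilon> $ i * \<omega> $ i", OF pm prod] by blast
  define \<pi> where "\<pi> = Transposition.transpose 1 m"
  have bij: "bij \<pi>" and \<pi>\<pi>: "\<pi> (\<pi> i) = i" and \<pi>m: "\<pi> i = m \<longleftrightarrow> i = 1" for i
    by (auto simp: \<pi>_def Transposition.transpose_def)
  have reindex: "(\<Sum>i\<in>UNIV. g (\<pi> i)) = (\<Sum>i\<in>UNIV. g i)" for g :: "4 \<Rightarrow> 'x::comm_monoid_add"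
    using bij by (rule sum.reindex_bij_betw)
  define \<delta> :: "real^4" where "\<delta> = (\<chi> i. \<epsilon> $ \<pi> i)"
  define w :: "real^3^4" where "w = (\<chi> i. \<delta> $ i *\<^sub>R v $ \<pi> i)"
  have \<delta>: "\<delta> \<in> sign_vectors"
    using \<epsilon>(1) by (simp add: \<delta>_def sign_vectors_def)
  have w_nth: "w $ i = \<delta> $ i *\<^sub>R v $ \<pi> i" for i
    by (simp add: w_def)
  have w: "w \<in> configurations"
    using v sign_vectors_abs[OF \<delta>] by (simp add: configurations_def w_nth)
  have active: "(norm (signed_sum w \<eta>))\<^sup>2 = max_sq_norm v"
    if \<eta>: "\<eta> \<in> sign_vectors"
      and orth: "\<eta> $ 1 + \<eta> $ 2 + \<eta> $ 3 + \<eta> $ 4 = 0 \<or> - \<eta> $ 1 + \<eta> $ 2 + \<eta> $ 3 + \<eta> $ 4 = 0" for \<eta>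
  proof -
    define \<eta>' :: "real^4" where "\<eta>' = (\<chi> i. \<epsilon> $ i * \<eta> $ \<pi> i)"
    have \<eta>': "\<eta>' \<in> sign_vectors"
      unfolding \<eta>'_def by (rule sign_vectors_mult_permuted[OF \<epsilon>(1) \<eta>])
    have sums: "signed_sum w \<eta> = signed_sum v \<eta>'"
      unfolding signed_sum_def reindex[of "\<lambda>i. \<eta>' $ i *\<^sub>R v $ i", symmetric]
      by (simp add: \<eta>'_def w_nth \<delta>_def \<pi>\<pi> mult.commute)
    have "\<epsilon> \<bullet> \<eta>' = (\<Sum>i\<in>UNIV. \<eta> $ \<pi> i)"
      using sign_vectors_sq[OF \<epsilon>(1)] by (simp add: inner_vec_def \<eta>'_def mult.assoc[symmetric])
    then have \<epsilon>\<eta>: "\<epsilon> \<bullet> \<eta>' = \<eta> $ 1 + \<eta> $ 2 + \<eta> $ 3 + \<eta> $ 4"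
      unfolding reindex by (simp add: sum_4)
    have "\<omega> \<bullet> \<eta>' = (\<Sum>i\<in>UNIV. (\<epsilon> $ \<pi> i * \<omega> $ \<pi> i) * \<eta> $ i)"
      unfolding inner_vec_def reindex[of "\<lambda>i. \<omega> $ i \<bullet> \<eta>' $ i", symmetric]
      by (simp add: \<eta>'_def \<pi>\<pi> mult_ac)
    also have "\<dots> = \<sigma> * (- \<eta> $ 1 + \<eta> $ 2 + \<eta> $ 3 + \<eta> $ 4)"
      by (simp add: m(2) \<pi>m sum_4 algebra_simps)
    finally have \<omega>\<eta>: "\<omega> \<bullet> \<eta>' = \<sigma> * (- \<eta> $ 1 + \<eta> $ 2 + \<eta> $ 3 + \<eta> $ 4)" .
    note isolated = inactive_signs_isolated[OF v span min _ _ \<eta>']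
    from orth show ?thesis
    proof
      assume "\<eta> $ 1 + \<eta> $ 2 + \<eta> $ 3 + \<eta> $ 4 = 0"
      then show ?thesis
        using isolated[OF \<epsilon>(1,2)] \<epsilon>\<eta> by (simp add: sums)
    next
      assume "- \<eta> $ 1 + \<eta> $ 2 + \<eta> $ 3 + \<eta> $ 4 = 0"
      then show ?thesis
        using isolated[OF \<omega>(1,2)] \<omega>\<eta> by (simp add: sums)
    qed
  qed
  define t where "t = (max_sq_norm v - 4) / 2"
  have "a * b * (w $ 1 \<bullet> w $ 2) + a * c * (w $ 1 \<bullet> w $ 3) + a * d * (w $ 1 \<bullet> w $ 4)
      + b * c * (w $ 2 \<bullet> w $ 3) + b * d * (w $ 2 \<bullet> w $ 4) + c * d * (w $ 3 \<bullet> w $ 4) = t"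
    if "{a, b, c, d} \<subseteq> {-1, 1}" "a + b + c + d = 0 \<or> - a + b + c + d = 0" for a b c d
    using active[of "signs a b c d"] norm_signed_sum_sq[OF w, of "signs a b c d"] that
    by (simp add: t_def)
  note q = this[of 1 1 "-1" "-1"] this[of 1 "-1" 1 "-1"] this[of 1 "-1" "-1" 1]
    this[of 1 1 1 "-1"] this[of 1 1 "-1" 1] this[of 1 "-1" 1 1]
  have gram0: "w $ 1 \<bullet> w $ 2 = 0" "w $ 1 \<bullet> w $ 3 = 0" "w $ 1 \<bullet> w $ 4 = 0"
    and gram_t: "w $ 2 \<bullet> w $ 3 = - t" "w $ 2 \<bullet> w $ 4 = - t" "w $ 3 \<bullet> w $ 4 = - t"
    using q by simp_all
  have unit: "w $ i \<bullet> w $ i = 1" for i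
    using w by (auto simp: configurations_def norm_eq_1)
  \<comment> \<open>The dependency of \<open>v\<close>, transported to \<open>w\<close>.\<close>
  define d where "d i = \<delta> $ i * c $ \<pi> i" for i
  have "(\<Sum>i\<in>UNIV. d i *\<^sub>R w $ i) = (\<Sum>i\<in>UNIV. c $ \<pi> i *\<^sub>R v $ \<pi> i)"
    by (rule sum.cong) (use sign_vectors_sq[OF \<delta>] in \<open>simp_all add: d_def w_nth mult.assoc mult.left_commute\<close>)
  then have "(\<Sum>i\<in>UNIV. d i *\<^sub>R w $ i) = 0"
    using reindex[of "\<lambda>i. c $ i *\<^sub>R v $ i"] by (simp add: c(2))
  then have "w $ j \<bullet> (\<Sum>i\<in>UNIV. d i *\<^sub>R w $ i) = 0" for j
    by simp
  note z = this[of 1] this[of 2] this[of 3] this[of 4]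
  have d1: "d 1 = 0" and rows: "d 2 - t * d 3 - t * d 4 = 0" "d 3 - t * d 2 - t * d 4 = 0"
      "d 4 - t * d 2 - t * d 3 = 0"
    using z gram0 gram_t unit by (simp_all add: sum_4 inner_add_right inner_commute algebra_simps)
  have "0 < t"
    using gt4 by (simp add: t_def)
  have "(d 2 - d 3) * (1 + t) = 0" "(d 2 - d 4) * (1 + t) = 0"
    using rows by (simp_all add: algebra_simps)
  then have eq: "d 3 = d 2" "d 4 = d 2"
    using \<open>0 < t\<close> by auto
  have "d 2 \<noteq> 0"
  proof
    assume "d 2 = 0"
    then have "\<forall>i. d i = 0"
      using d1 eq by (simp add: forall_4)
    then have "c $ \<pi> i = 0" for i
      using sign_vectors_abs[OF \<delta>, of i] by (auto simp: d_def dest!: spec[of _ i])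
    then have "c $ i = 0" for i
      by (metis \<pi>\<pi>)
    then have "c = 0"
      by (simp add: vec_eq_iff)
    then show False
      using c(1) by simp
  qed
  moreover have "d 2 * (1 - 2 * t) = 0"
    using rows(1) by (simp add: eq algebra_simps)
  ultimately have "t = 1/2"
    by simp
  then show ?thesis
    using that[OF bij \<delta> w w_nth gram0] gram_t by simp
qed

lemma triangular_pyramid_type_of_gram:
  fixes v w :: "real^3^4"
  assumes "bij \<pi>" "\<delta> \<in> sign_vectors" "w \<in> configurations" "\<And>i. w $ i = \<delta> $ i *\<^sub>R v $ \<pi> i"
    and orth: "w $ 1 \<bullet> w $ 2 = 0" "w $ 1 \<bullet> w $ 3 = 0" "w $ 1 \<bullet> w $ 4 = 0"
    and obtuse: "w $ 2 \<bullet> w $ 3 = -1/2" "w $ 2 \<bullet> w $ 4 = -1/2" "w $ 3 \<bullet> w $ 4 = -1/2"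
  shows "triangular_pyramid_type v"
proof -
  have norm: "norm (w $ i) = 1" for i
    using assms(3) by (simp add: configurations_def)
  obtain f :: "real^3 \<Rightarrow> real^3" where f: "orthogonal_transformation f" "f (w $ 1) = axis 3 1"
    using orthogonal_transformation_exists_1[of "w $ 1" "axis 3 1"] norm by auto
  define u :: "real^3^4" where "u = (\<chi> i. f (w $ i))"
  have "config_equiv v u"
    unfolding config_equiv_def
    using assms(1,2,4) f(1)
    by (intro exI[of _ \<pi>] exI[of _ \<delta>] exI[of _ f])
      (auto simp: u_def orthogonal_transformation_def linear_cmul)
  moreover have "{u $ 1, - (u $ 1)} = {axis 3 1, - axis 3 1}"
    by (simp add: u_def f)
  moreover have "{u $ 2, u $ 3, u $ 4} \<subseteq> equator"
  proof -
    have "u $ i \<in> equator" if "w $ 1 \<bullet> w $ i = 0" for i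
    proof -
      have "u $ i $ 3 = axis 3 1 \<bullet> f (w $ i)"
        by (simp add: u_def inner_axis')
      also have "\<dots> = w $ 1 \<bullet> w $ i"
        using f by (metis orthogonal_transformation_def)
      finally show ?thesis
        using that f(1) norm[of i] by (simp add: equator_def u_def orthogonal_transformation_norm)
    qed
    then show ?thesis
      using orth by simp
  qed
  moreover have "equilateral_triangle (u $ 2) (u $ 3) (u $ 4)"
  proof -
    have "dist (u $ i) (u $ j) = sqrt 3" if "w $ i \<bullet> w $ j = -1/2" for i j
    proof -
      have "dist (u $ i) (u $ j) = norm (w $ i - w $ j)"
        using f(1) by (simp add: u_def dist_norm orthogonal_transformation_def
            orthogonal_transformation_norm flip: linear_diff)
      also have "\<dots> = sqrt 3"
        using that norm[of i] norm[of j]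
        by (simp add: norm_eq_sqrt_inner inner_diff_left inner_diff_right inner_commute)
      finally show ?thesis .
    qed
    then have "dist (u $ 2) (u $ 3) = sqrt 3" "dist (u $ 3) (u $ 4) = sqrt 3" "dist (u $ 4) (u $ 2) = sqrt 3"
      using obtuse by (simp_all add: inner_commute)
    then show ?thesis
      by (auto simp: equilateral_triangle_def)
  qed
  ultimately show ?thesis
    unfolding triangular_pyramid_type_def by blast
qed

section \<open>Invariance under equivalence of configurations\<close>

lemma signed_sum_orthogonal_image:
  assumes "orthogonal_transformation f" "bij \<pi>"
    and w: "\<And>i. w $ i = \<delta> $ i *\<^sub>R f (v $ \<pi> i)" and \<delta>: "\<delta> \<in> sign_vectors"
  shows "norm (signed_sum w (\<chi> i. \<delta> $ i * \<zeta> $ \<pi> i)) = norm (signed_sum v \<zeta>)"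
proof -
  have lin: "linear f"
    using assms(1) by (simp add: orthogonal_transformation_def)
  have "signed_sum w (\<chi> i. \<delta> $ i * \<zeta> $ \<pi> i) = (\<Sum>i\<in>UNIV. \<zeta> $ \<pi> i *\<^sub>R f (v $ \<pi> i))"
    unfolding signed_sum_def
    by (rule sum.cong) (use sign_vectors_sq[OF \<delta>] in \<open>simp_all add: w mult_ac\<close>)
  also have "\<dots> = (\<Sum>i\<in>UNIV. \<zeta> $ i *\<^sub>R f (v $ i))"
    by (rule sum.reindex_bij_betw[OF assms(2)])
  also have "\<dots> = f (signed_sum v \<zeta>)"
    by (simp add: signed_sum_def linear_sum[OF lin] linear_cmul[OF lin])
  finally show ?thesis
    using assms(1) by (simp add: orthogonal_transformation_norm)
qed

lemma config_equiv_max_sq_norm_le: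
  assumes "config_equiv v w"
  shows "max_sq_norm v \<le> max_sq_norm w"
proof -
  obtain \<pi> \<delta> f where *: "bij \<pi>" "\<delta> \<in> sign_vectors" "orthogonal_transformation f"
    "\<And>i. w $ i = \<delta> $ i *\<^sub>R f (v $ \<pi> i)"
    using assms by (auto simp: config_equiv_def)
  obtain \<zeta> where \<zeta>: "\<zeta> \<in> sign_vectors" "max_sq_norm v = (norm (signed_sum v \<zeta>))\<^sup>2"
    by (rule max_sq_norm_attained)
  have "(\<chi> i. \<delta> $ i * \<zeta> $ \<pi> i) \<in> sign_vectors"
    by (rule sign_vectors_mult_permuted[OF *(2) \<zeta>(1)])
  from signed_sum_le_max_sq_norm[OF this, of w] show ?thesis
    unfolding signed_sum_orthogonal_image[OF *(3,1,4,2)] \<zeta>(2) .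
qed

lemma config_equiv_sym:
  assumes "config_equiv v w" shows "config_equiv w v"
proof -
  obtain \<pi> \<delta> f where *: "bij \<pi>" "\<delta> \<in> sign_vectors" "orthogonal_transformation f"
    "\<And>i. w $ i = \<delta> $ i *\<^sub>R f (v $ \<pi> i)"
    using assms by (auto simp: config_equiv_def)
  define \<rho> where "\<rho> = inv \<pi>"
  have \<rho>: "bij \<rho>" "\<pi> (\<rho> i) = i" for i
    using *(1) by (auto simp: \<rho>_def bij_imp_bij_inv bij_is_surj surj_f_inv_f)
  have g: "orthogonal_transformation (inv f)" "inv f (f x) = x" for x
    using *(3) by (auto simp: orthogonal_transformation_inv orthogonal_transformation_inj)
  have "v $ i = (\<chi> i. \<delta> $ \<rho> i) $ i *\<^sub>R inv f (w $ \<rho> i)" for i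
    using g sign_vectors_sq[OF *(2), of "\<rho> i"]
    by (simp add: *(4) \<rho> orthogonal_transformation_def linear_cmul)
  moreover have "(\<chi> i. \<delta> $ \<rho> i) \<in> sign_vectors"
    using *(2) by (simp add: sign_vectors_def)
  ultimately show ?thesis
    unfolding config_equiv_def using \<rho>(1) g(1) by blast
qed

lemma config_equiv_max_sq_norm:
  "config_equiv v w \<Longrightarrow> max_sq_norm v = max_sq_norm w"
  using config_equiv_max_sq_norm_le config_equiv_sym by (metis order_antisym)

lemma config_equiv_configurations:
  assumes "config_equiv v w" "v \<in> configurations"
  shows "w \<in> configurations"
proof -
  obtain \<pi> \<delta> f where *: "bij \<pi>" "\<delta> \<in> sign_vectors" "orthogonal_transformation f"
    "\<And>i. w $ i = \<delta> $ i *\<^sub>R f (v $ \<pi> i)"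
    using assms(1) by (auto simp: config_equiv_def)
  then show ?thesis
    using assms(2) sign_vectors_abs[OF *(2)]
    by (auto simp: configurations_def orthogonal_transformation_norm)
qed

lemma config_equiv_orthogonal:
  assumes "orthogonal_transformation f"
  shows "config_equiv v (\<chi> i. f (v $ i))"
  unfolding config_equiv_def
  by (rule exI[of _ id], rule exI[of _ "\<chi> i. 1"], rule exI[of _ f])
    (simp add: assms ones_in_sign_vectors)

section \<open>Coplanar configurations\<close>

text \<open>The maximal length of a signed sum is at least its component in the direction \<open>d\<close>, and the signs
  can be chosen so that all four components in this direction add up.\<close>

lemma sum_abs_inner_le:
  fixes v :: "real^3^4"
  assumes "norm d = 1"
  shows "(\<Sum>i\<in>UNIV. \<bar>d \<bullet> v $ i\<bar>)\<^sup>2 \<le> max_sq_norm v"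
proof -
  define \<delta> :: "real^4" where "\<delta> = (\<chi> i. if d \<bullet> v $ i < 0 then -1 else 1)"
  have \<delta>: "\<delta> \<in> sign_vectors"
    by (simp add: \<delta>_def sign_vectors_def)
  have "(\<Sum>i\<in>UNIV. \<bar>d \<bullet> v $ i\<bar>) = d \<bullet> signed_sum v \<delta>"
    unfolding signed_sum_def inner_sum_right
    by (rule sum.cong) (auto simp: \<delta>_def)
  also have "\<dots> \<le> norm (signed_sum v \<delta>)"
    using norm_cauchy_schwarz[of d "signed_sum v \<delta>"] assms by simp
  finally have "(\<Sum>i\<in>UNIV. \<bar>d \<bullet> v $ i\<bar>)\<^sup>2 \<le> (norm (signed_sum v \<delta>))\<^sup>2"
    by (intro power_mono sum_nonneg) auto
  then show ?thesis
    using signed_sum_le_max_sq_norm[OF \<delta>, of v] by (rule order_trans)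
qed

text \<open>The three terms are the components of a unit vector of the plane along three directions at
  angles of 60 degrees. Since \<open>\<bar>p + q\<bar> + \<bar>p - q\<bar> = 2 max \<bar>p\<bar> \<bar>q\<bar>\<close>, the sum is
  \<open>\<bar>y\<bar> + max (sqrt 3 * \<bar>x\<bar>) \<bar>y\<bar>\<close>, and the bound is attained at the three directions orthogonal to these.\<close>

lemma three_directions_lower_bound:
  fixes x y :: real
  assumes "x\<^sup>2 + y\<^sup>2 = 1"
  shows "sqrt 3 \<le> \<bar>y\<bar> + \<bar>sqrt 3 / 2 * x + y / 2\<bar> + \<bar>sqrt 3 / 2 * x - y / 2\<bar>"
proof -
  define a b where "a = \<bar>x\<bar>" and "b = \<bar>y\<bar>"
  have ab: "a\<^sup>2 + b\<^sup>2 = 1" "0 \<le> a" "0 \<le> b"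
    using assms by (simp_all add: a_def b_def)
  have "sqrt 3 \<le> b + sqrt 3 * a \<or> sqrt 3 \<le> b + b"
  proof (cases "1 \<le> 2 * a")
    case True
    have "a\<^sup>2 \<le> 1\<^sup>2"
      unfolding one_power2 using ab(1) zero_le_power2[of b] by linarith
    then have "a \<le> 1"
      by (rule power2_le_imp_le) simp
    have "0 \<le> (1 - a) * (4 * a - 2)"
      using \<open>a \<le> 1\<close> True by simp
    then have "(sqrt 3 * (1 - a))\<^sup>2 \<le> b\<^sup>2"
      using ab(1) by (simp add: power_mult_distrib power2_eq_square algebra_simps)
    then have "sqrt 3 * (1 - a) \<le> b"
      using ab(3) by (rule power2_le_imp_le)
    then show ?thesis
      by (simp add: algebra_simps)
  next
    case False
    then have "a\<^sup>2 \<le> (1/2)\<^sup>2"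
      using ab by (intro power_mono) auto
    then have "(sqrt 3)\<^sup>2 \<le> (2 * b)\<^sup>2"
      using ab(1) by (simp add: power2_eq_square)
    then have "sqrt 3 \<le> 2 * b"
      by (rule power2_le_imp_le) (simp add: ab)
    then show ?thesis by simp
  qed
  moreover have "sqrt 3 * a = \<bar>sqrt 3 * x\<bar>"
    by (simp add: a_def abs_mult)
  ultimately show ?thesis
    by (auto simp: b_def)
qed

text \<open>Summing the previous bound over the four vectors, one of the three directions carries total
  component at least \<open>4 / sqrt 3\<close>.\<close>

lemma coplanar_lower_bound:
  fixes v :: "real^3^4"
  assumes v: "v \<in> configurations" and span: "span (range (($) v)) \<noteq> UNIV"
  shows "16 / 3 \<le> max_sq_norm v"
proof -
  obtain n0 :: "real^3" where n0: "n0 \<noteq> 0" "\<And>x. x \<in> span (range (($) v)) \<Longrightarrow> n0 \<bullet> x = 0"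
    using span_not_univ_subset_hyperplane[OF span] by auto
  define n where "n = n0 /\<^sub>R norm n0"
  have n: "norm n = 1" "n \<bullet> v $ i = 0" for i
    using n0(1) n0(2)[of "v $ i"] by (simp_all add: n_def span_base)
  obtain f :: "real^3 \<Rightarrow> real^3" where f: "orthogonal_transformation f" "f n = axis 3 1"
    using orthogonal_transformation_exists_1[of n "axis 3 1"] n(1) by auto
  define u :: "real^3^4" where "u = (\<chi> i. f (v $ i))"
  have equiv: "config_equiv v u"
    unfolding u_def by (rule config_equiv_orthogonal[OF f(1)])
  have third: "u $ i $ 3 = 0" for i
  proof -
    have "u $ i $ 3 = axis 3 1 \<bullet> f (v $ i)"
      by (simp add: u_def inner_axis')
    also have "\<dots> = n \<bullet> v $ i"
      using f by (metis orthogonal_transformation_def)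
    finally show ?thesis
      by (simp add: n)
  qed
  have unit: "(u $ i $ 1)\<^sup>2 + (u $ i $ 2)\<^sup>2 = 1" for i
  proof -
    have "norm (u $ i) = 1"
      using config_equiv_configurations[OF equiv v] by (simp add: configurations_def)
    then show ?thesis
      by (simp add: norm_eq_1 inner_vec_def sum_3 third power2_eq_square)
  qed
  define S where "S d = (\<Sum>i\<in>UNIV. \<bar>d \<bullet> u $ i\<bar>)" for d :: "real^3"
  define d1 d2 d3 :: "real^3" where "d1 = vector [0, 1, 0]"
    and "d2 = vector [sqrt 3 / 2, 1 / 2, 0]" and "d3 = vector [sqrt 3 / 2, - 1 / 2, 0]"
  have norm_d: "norm d1 = 1" "norm d2 = 1" "norm d3 = 1"
    by (simp_all add: d1_def d2_def d3_def norm_eq_1 inner_vec_def sum_3)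
  have "(\<Sum>i::4\<in>UNIV. sqrt 3) \<le> (\<Sum>i\<in>UNIV. \<bar>d1 \<bullet> u $ i\<bar> + \<bar>d2 \<bullet> u $ i\<bar> + \<bar>d3 \<bullet> u $ i\<bar>)"
    using three_directions_lower_bound[OF unit]
    by (intro sum_mono) (simp add: d1_def d2_def d3_def inner_vec_def sum_3 third)
  then have "4 * sqrt 3 \<le> S d1 + S d2 + S d3"
    by (simp add: S_def sum.distrib)
  then have "4 * sqrt 3 / 3 \<le> S d1 \<or> 4 * sqrt 3 / 3 \<le> S d2 \<or> 4 * sqrt 3 / 3 \<le> S d3"
    by argo
  then have "\<exists>d. norm d = 1 \<and> 4 * sqrt 3 / 3 \<le> S d"
    using norm_d by blast
  then obtain d where d: "norm d = 1" "4 * sqrt 3 / 3 \<le> S d"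
    by blast
  have "16 / 3 = (4 * sqrt 3 / 3)\<^sup>2"
    by (simp add: power_mult_distrib power_divide)
  also have "\<dots> \<le> (S d)\<^sup>2"
    using d(2) by (intro power_mono) auto
  also have "\<dots> \<le> max_sq_norm u"
    unfolding S_def by (rule sum_abs_inner_le[OF d(1)])
  finally show ?thesis
    by (simp add: config_equiv_max_sq_norm[OF equiv])
qed

section \<open>Existence of a global minimum\<close>

lemma compact_configurations: "compact configurations"
proof -
  have "closed configurations"
    unfolding configurations_def mem_sphere_0
    by (intro closed_Collect_all closed_Collect_eq continuous_intros)
  moreover have "bounded configurations"
  proof (rule boundedI)
    fix v assume "v \<in> configurations"
    then show "norm v \<le> 4"
      using L2_set_le_sum[of UNIV "\<lambda>i. norm (v $ i)"] by (simp add: norm_vec_def configurations_def)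
  qed
  ultimately show ?thesis
    by (simp add: compact_eq_bounded_closed)
qed

lemma continuous_on_Max:
  fixes f :: "'a \<Rightarrow> 'b::topological_space \<Rightarrow> real"
  assumes "finite A" "A \<noteq> {}" "\<And>a. a \<in> A \<Longrightarrow> continuous_on S (f a)"
  shows "continuous_on S (\<lambda>x. Max ((\<lambda>a. f a x) ` A))"
  using assms by (induction A rule: finite_ne_induct) (auto intro!: continuous_on_max)

lemma continuous_on_max_sq_norm: "continuous_on S max_sq_norm"
  unfolding max_sq_norm_def
  by (intro continuous_on_Max finite_sign_vectors continuous_intros)
    (use ones_in_sign_vectors in auto)

lemma ex_global_minimum: "\<exists>v\<in>configurations. \<forall>w\<in>configurations. max_sq_norm v \<le> max_sq_norm w"
proof -
  have "(\<chi> i. axis 1 1) \<in> configurations"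
    by (simp add: configurations_def)
  then show ?thesis
    by (intro continuous_attains_inf compact_configurations continuous_on_max_sq_norm) auto
qed

section \<open>Values at triangular pyramids and at cubes\<close>

text \<open>Let \<open>\<beta>\<close> be the common inner product, and let \<open>D\<close> and \<open>E\<close> be the components of \<open>q\<close> and \<open>r\<close> orthogonal
  to \<open>p\<close> in the plane. Then \<open>D\<^sup>2 = E\<^sup>2 = 1 - \<beta>\<^sup>2\<close> and \<open>\<beta> = q \<bullet> r = \<beta>\<^sup>2 + D E\<close>. Eliminating \<open>D\<close> and \<open>E\<close>
  leaves \<open>\<beta> = 1\<close>, which would make the vertices coincide, or \<open>\<beta> = -1/2\<close>.\<close>

lemma planar_equilateral_inner:
  fixes p q r :: "real^3"
  assumes eq: "p \<in> equator" "q \<in> equator" "r \<in> equator" and tri: "equilateral_triangle p q r"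
  shows "p \<bullet> q = -1/2" "p \<bullet> r = -1/2" "q \<bullet> r = -1/2"
proof -
  have unit: "p \<bullet> p = 1" "q \<bullet> q = 1" "r \<bullet> r = 1" and z: "p $ 3 = 0" "q $ 3 = 0" "r $ 3 = 0"
    using eq by (simp_all add: equator_def norm_eq_1)
  have dist: "(dist a b)\<^sup>2 = a \<bullet> a + b \<bullet> b - 2 * (a \<bullet> b)" for a b :: "real^3"
    by (simp add: dist_norm power2_norm_eq_inner inner_diff_left inner_diff_right inner_commute)
  define \<beta> where "\<beta> = p \<bullet> q"
  have "(dist p q)\<^sup>2 = (dist q r)\<^sup>2" "(dist q r)\<^sup>2 = (dist r p)\<^sup>2" "p \<noteq> q"
    using tri by (simp_all add: equilateral_triangle_def)
  then have b: "p \<bullet> q = \<beta>" "q \<bullet> r = \<beta>" "p \<bullet> r = \<beta>"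
    unfolding dist by (simp_all add: unit \<beta>_def inner_commute)
  have "\<beta> \<noteq> 1"
  proof
    assume "\<beta> = 1"
    then have "(dist p q)\<^sup>2 = 0"
      unfolding dist by (simp add: unit b)
    with \<open>p \<noteq> q\<close> show False by simp
  qed
  define D where "D = p $ 1 * q $ 2 - p $ 2 * q $ 1"
  define E where "E = p $ 1 * r $ 2 - p $ 2 * r $ 1"
  note c = inner_vec_def sum_3 z inner_real_def
  have DE: "D * D = 1 - \<beta> * \<beta>" "E * E = 1 - \<beta> * \<beta>" "\<beta> = \<beta> * \<beta> + D * E"
  proof -
    have "D * D + (p \<bullet> q) * (p \<bullet> q) = (p \<bullet> p) * (q \<bullet> q)"
      "E * E + (p \<bullet> r) * (p \<bullet> r) = (p \<bullet> p) * (r \<bullet> r)"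
      "D * E + (p \<bullet> q) * (p \<bullet> r) = (p \<bullet> p) * (q \<bullet> r)"
      by (simp_all add: D_def E_def c algebra_simps)
    then show "D * D = 1 - \<beta> * \<beta>" "E * E = 1 - \<beta> * \<beta>" "\<beta> = \<beta> * \<beta> + D * E"
      by (simp_all add: unit b)
  qed
  have "D * E = \<beta> - \<beta> * \<beta>"
    using DE(3) by simp
  moreover have "(D * E) * (D * E) = (D * D) * (E * E)"
    by simp
  ultimately have "(\<beta> - \<beta> * \<beta>) * (\<beta> - \<beta> * \<beta>) = (1 - \<beta> * \<beta>) * (1 - \<beta> * \<beta>)"
    by (simp only: DE(1,2))
  then have "(\<beta> - 1) * (\<beta> - 1) * (2 * \<beta> + 1) = 0"
    by (simp add: algebra_simps)
  then have "\<beta> = -1/2"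
    using \<open>\<beta> \<noteq> 1\<close> by auto
  then show "p \<bullet> q = -1/2" "p \<bullet> r = -1/2" "q \<bullet> r = -1/2"
    using b by simp_all
qed

lemma max_sq_norm_eqI:
  assumes "\<And>\<delta>. \<delta> \<in> sign_vectors \<Longrightarrow> (norm (signed_sum v \<delta>))\<^sup>2 \<le> m" and "m \<le> max_sq_norm v"
  shows "max_sq_norm v = m"
  using assms max_sq_norm_attained[of v] by (metis order_antisym)

lemma triangular_pyramid_value:
  fixes v :: "real^3^4"
  assumes v: "v \<in> configurations" and type: "triangular_pyramid_type v"
  shows "max_sq_norm v = 5"
proof -
  obtain w where equiv: "config_equiv v w"
    and pole: "{w $ 1, - (w $ 1)} = {axis 3 1, - axis 3 1}"
    and eq: "w $ 2 \<in> equator" "w $ 3 \<in> equator" "w $ 4 \<in> equator"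
    and tri: "equilateral_triangle (w $ 2) (w $ 3) (w $ 4)"
    using type by (auto simp: triangular_pyramid_type_def)
  have w: "w \<in> configurations"
    by (rule config_equiv_configurations[OF equiv v])
  have "w $ 1 = axis 3 1 \<or> w $ 1 = - axis 3 1"
    using pole by blast
  then have orth: "w $ 1 \<bullet> x = 0" if "x \<in> equator" for x
    using that by (auto simp: equator_def inner_axis')
  have value_eq: "(norm (signed_sum w \<delta>))\<^sup>2
      = 4 - (\<delta> $ 2 * \<delta> $ 3 + \<delta> $ 2 * \<delta> $ 4 + \<delta> $ 3 * \<delta> $ 4)" if "\<delta> \<in> sign_vectors" for \<delta>
    by (simp add: norm_signed_sum_sq[OF w that] orth eq planar_equilateral_inner[OF eq tri])
  have "max_sq_norm w = 5"
  proof (rule max_sq_norm_eqI)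
    fix \<delta> :: "real^4" assume \<delta>: "\<delta> \<in> sign_vectors"
    then have "\<delta> $ i = -1 \<or> \<delta> $ i = 1" for i
      by (auto simp: sign_vectors_def)
    from this[of 2] this[of 3] this[of 4] show "(norm (signed_sum w \<delta>))\<^sup>2 \<le> 5"
      unfolding value_eq[OF \<delta>] by (elim disjE) simp_all
  next
    show "5 \<le> max_sq_norm w"
      using value_eq[of "signs 1 1 1 (-1)"] signed_sum_le_max_sq_norm[of "signs 1 1 1 (-1)" w] by simp
  qed
  then show ?thesis
    by (simp add: config_equiv_max_sq_norm[OF equiv])
qed

lemma ex_triangular_pyramid:
  obtains v where "v \<in> configurations" "triangular_pyramid_type v"
proof -
  define v :: "real^3^4" where "v = (\<chi> i. if i = 1 then axis 3 1 else if i = 2 then vector [1, 0, 0]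
    else if i = 3 then vector [- 1 / 2, sqrt 3 / 2, 0] else vector [- 1 / 2, - sqrt 3 / 2, 0])"
  have nth: "v $ 1 = axis 3 1" "v $ 2 = vector [1, 0, 0]" "v $ 3 = vector [- 1 / 2, sqrt 3 / 2, 0]"
    "v $ 4 = vector [- 1 / 2, - sqrt 3 / 2, 0]"
    by (simp_all add: v_def)
  have eq: "v $ 2 \<in> equator" "v $ 3 \<in> equator" "v $ 4 \<in> equator"
    by (simp_all add: nth equator_def norm_eq_1 inner_vec_def sum_3)
  have dist: "dist (v $ 2) (v $ 3) = sqrt 3" "dist (v $ 3) (v $ 4) = sqrt 3" "dist (v $ 4) (v $ 2) = sqrt 3"
    by (simp_all add: nth dist_norm norm_eq_sqrt_inner inner_vec_def sum_3 field_simps)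
  have "v \<in> configurations"
    using eq by (simp add: configurations_def forall_4 equator_def nth(1))
  moreover have "config_equiv v v"
    using config_equiv_orthogonal[of "\<lambda>x. x" v] by (simp add: orthogonal_transformation_def linear_ident)
  then have "triangular_pyramid_type v"
    unfolding triangular_pyramid_type_def
    using eq dist by (intro exI[of _ v]) (auto simp: nth(1) equilateral_triangle_def)
  ultimately show ?thesis
    using that by blast
qed

lemma sum_sign_vectors_3:
  fixes h :: "real^3 \<Rightarrow> 'b::comm_monoid_add"
  shows "(\<Sum>x\<in>sign_vectors. h x) = (\<Sum>a\<in>{-1, 1}. \<Sum>b\<in>{-1, 1}. \<Sum>c\<in>{-1, 1}. h (vector [a, b, c]))"
proof -
  let ?P = "{-1, 1} \<times> {-1, 1} \<times> {-1, 1 :: real}"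
  let ?v = "\<lambda>(a, b, c). vector [a, b, c] :: real^3"
  have image: "sign_vectors = ?v ` ?P"
  proof
    show "sign_vectors \<subseteq> ?v ` ?P"
    proof
      fix x :: "real^3" assume "x \<in> sign_vectors"
      then have "x $ i \<in> {-1, 1}" for i
        by (simp add: sign_vectors_def)
      then have "(x $ 1, x $ 2, x $ 3) \<in> ?P"
        by (intro SigmaI)
      moreover have "x = ?v (x $ 1, x $ 2, x $ 3)"
        by (simp add: vec_eq_iff forall_3)
      ultimately show "x \<in> ?v ` ?P"
        by (rule rev_image_eqI)
    qed
    show "?v ` ?P \<subseteq> sign_vectors"
      by (simp add: image_subset_iff sign_vectors_def forall_3)
  qed
  have inj: "inj_on ?v ?P"
  proof (rule inj_onI)
    fix p q assume "?v p = ?v q"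
    then have "?v p $ 1 = ?v q $ 1" "?v p $ 2 = ?v q $ 2" "?v p $ 3 = ?v q $ 3"
      by simp_all
    then show "p = q"
      by (cases p, cases q) simp
  qed
  have "(\<Sum>x\<in>sign_vectors. h x) = sum (h \<circ> ?v) ?P"
    by (simp only: image sum.reindex[OF inj])
  also have "\<dots> = (\<Sum>a\<in>{-1, 1}. \<Sum>b\<in>{-1, 1}. \<Sum>c\<in>{-1, 1}. h (vector [a, b, c]))"
    unfolding sum.cartesian_product by (rule sum.cong) auto
  finally show ?thesis .
qed

text \<open>The vertices \<open>\<plusminus>w\<^sub>i\<close> of a cube inscribed in the sphere form a tight frame, because the eight sign
  vectors of \<open>\<real>\<^sup>3\<close> do. The set of vertices is symmetric about the origin, which makes the center of the
  cube zero, and the unit length of the vertices fixes the scale. Since the cube has eight vertices,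
  the vectors \<open>\<plusminus>w\<^sub>i\<close> are pairwise different, so a sum over the vertices is a sum over the index and
  the sign.\<close>

lemma cube_frame:
  fixes w :: "real^3^4"
  assumes w: "w \<in> configurations" and cube: "cube_vertices (\<Union>i. {w $ i, - (w $ i)})"
  obtains s and f :: "real^3 \<Rightarrow> real^3" where "16 * s\<^sup>2 = 16 / 3" "orthogonal_transformation f"
    "\<forall>i. \<exists>x\<in>sign_vectors. w $ i = s *\<^sub>R f x"
    "\<forall>u. (\<Sum>i\<in>UNIV. (w $ i \<bullet> u)\<^sup>2) = 4 / 3 * (u \<bullet> u)"
proof -
  define V where "V = (\<Union>i. {w $ i, - (w $ i)})"
  obtain c s and f :: "real^3 \<Rightarrow> real^3" where s: "0 < s" and f: "orthogonal_transformation f"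
    and V: "V = (\<lambda>x. c + s *\<^sub>R f x) ` sign_vectors"
    using cube by (auto simp: cube_vertices_def V_def)
  have lin: "linear f" and injf: "inj f"
    using f by (simp_all add: orthogonal_transformation_def orthogonal_transformation_inj)
  have inj: "inj_on (\<lambda>x. c + s *\<^sub>R f x) sign_vectors"
    using s injf by (auto simp: inj_on_def)
  have "card (sign_vectors :: (real^3) set) = 8"
    using sum_sign_vectors_3[of "\<lambda>_. 1 :: nat"] by simp
  then have card: "card V = 8"
    unfolding V by (simp add: card_image[OF inj])
  define F where "F = (\<lambda>(i, b). b *\<^sub>R w $ i)"
  have "F ` (UNIV \<times> {1, -1}) = V"
    by (force simp: F_def V_def image_iff)
  moreover have "card (UNIV \<times> {1, -1 :: real} :: (4 \<times> real) set) = 8"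
    by (simp add: card_cartesian_product)
  ultimately have "inj_on F (UNIV \<times> {1, -1})"
    using card by (intro eq_card_imp_inj_on) auto
  then have sum_V: "(\<Sum>y\<in>V. h y) = (\<Sum>i\<in>UNIV. h (w $ i) + h (- (w $ i)))"
    for h :: "real^3 \<Rightarrow> 'x::comm_monoid_add"
  proof -
    have "(\<Sum>y\<in>V. h y) = sum (h \<circ> F) (UNIV \<times> {1, -1})"
      by (simp only: sum.reindex[OF \<open>inj_on F (UNIV \<times> {1, -1})\<close>, symmetric]
          \<open>F ` (UNIV \<times> {1, -1}) = V\<close>)
    also have "\<dots> = (\<Sum>i\<in>UNIV. \<Sum>b\<in>{1, -1}. h (b *\<^sub>R w $ i))"
      unfolding sum.cartesian_product by (rule sum.cong) (auto simp: F_def)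
    finally show ?thesis
      by simp
  qed
  have sum_V': "(\<Sum>y\<in>V. h y) = (\<Sum>x\<in>sign_vectors. h (c + s *\<^sub>R f x))"
    for h :: "real^3 \<Rightarrow> 'x::comm_monoid_add"
    unfolding V by (simp add: sum.reindex[OF inj])
  have zero: "(\<Sum>x\<in>sign_vectors. x) = (0 :: real^3)"
    unfolding sum_sign_vectors_3 by (simp add: vec_eq_iff forall_3)
  have "(\<Sum>x\<in>sign_vectors. s *\<^sub>R f x) = s *\<^sub>R f (\<Sum>x\<in>sign_vectors. x)"
    by (simp add: linear_sum[OF lin] scaleR_sum_right)
  then have "(\<Sum>x\<in>sign_vectors. s *\<^sub>R f x) = 0"
    by (simp add: zero linear_0[OF lin])
  then have "(\<Sum>y\<in>V. y) = 8 *\<^sub>R c"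
    by (simp only: sum_V' sum.distrib sum_constant_scaleR \<open>card sign_vectors = 8\<close>) simp
  moreover have "(\<Sum>y\<in>V. y) = 0"
    by (simp add: sum_V)
  ultimately have c: "c = 0"
    by simp
  have w_s: "\<exists>x\<in>sign_vectors. w $ i = s *\<^sub>R f x" for i
  proof -
    have "w $ i \<in> V" by (auto simp: V_def)
    then show ?thesis by (auto simp: V c)
  qed
  have s2: "s\<^sup>2 = 1 / 3"
  proof -
    obtain x where x: "x \<in> sign_vectors" "w $ 1 = s *\<^sub>R f x"
      using w_s by blast
    have "1 = w $ 1 \<bullet> w $ 1"
      using w by (auto simp: configurations_def norm_eq_1)
    also have "\<dots> = s\<^sup>2 * (x \<bullet> x)"
      using f by (simp add: x(2) orthogonal_transformation_def power2_eq_square)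
    finally show ?thesis
      using x(1) by (simp add: sign_vector_inner_self)
  qed
  have "(\<Sum>i\<in>UNIV. (w $ i \<bullet> u)\<^sup>2) = 4 / 3 * (u \<bullet> u)" for u
  proof -
    have "surj f"
      using f by (simp add: orthogonal_transformation_surj)
    then obtain t where t: "u = f t"
      by blast
    have "2 * (\<Sum>i\<in>UNIV. (w $ i \<bullet> u)\<^sup>2) = (\<Sum>y\<in>V. (y \<bullet> u)\<^sup>2)"
      by (simp add: sum_V sum_distrib_left)
    also have "\<dots> = (\<Sum>x\<in>sign_vectors. s\<^sup>2 * (x \<bullet> t)\<^sup>2)"
      using f by (simp add: sum_V' c t orthogonal_transformation_def power_mult_distrib)
    also have "\<dots> = s\<^sup>2 * (8 * (t \<bullet> t))"
      unfolding sum_sign_vectors_3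
      by (simp add: inner_vec_def sum_3 power2_eq_square algebra_simps)
    also have "t \<bullet> t = u \<bullet> u"
      using f by (simp add: t orthogonal_transformation_def)
    finally show ?thesis
      by (simp add: s2)
  qed
  then show ?thesis
    using that[of s f] s2 f w_s by simp
qed

text \<open>For \<open>u = \<Sum> \<delta>\<^sub>i w\<^sub>i\<close> the Cauchy-Schwarz inequality gives
  \<open>\<bar>u\<bar>\<^sup>4 = (\<Sum> \<delta>\<^sub>i (w\<^sub>i \<bullet> u))\<^sup>2 \<le> 4 \<Sum> (w\<^sub>i \<bullet> u)\<^sup>2 = 16/3 \<bar>u\<bar>\<^sup>2\<close>. Equality occurs for the signs that point all
  four vectors to one face of the cube: along the normal of a face every vertex has the same component
  up to sign.\<close>

lemma cube_value:
  fixes v :: "real^3^4"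
  assumes v: "v \<in> configurations" and type: "cube_type v"
  shows "max_sq_norm v = 16 / 3"
proof -
  obtain w where equiv: "config_equiv v w" and cube: "cube_vertices (\<Union>i. {w $ i, - (w $ i)})"
    using type by (auto simp: cube_type_def)
  have w: "w \<in> configurations"
    by (rule config_equiv_configurations[OF equiv v])
  obtain s and f :: "real^3 \<Rightarrow> real^3" where sf: "16 * s\<^sup>2 = 16 / 3" "orthogonal_transformation f"
    "\<forall>i. \<exists>x\<in>sign_vectors. w $ i = s *\<^sub>R f x"
    and frame: "\<forall>u. (\<Sum>i\<in>UNIV. (w $ i \<bullet> u)\<^sup>2) = 4 / 3 * (u \<bullet> u)"
    by (rule cube_frame[OF w cube])
  have "max_sq_norm w = 16 / 3"
  proof (rule max_sq_norm_eqI)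
    fix \<delta> :: "real^4" assume \<delta>: "\<delta> \<in> sign_vectors"
    define u where "u = signed_sum w \<delta>"
    define y :: "real^4" where "y = (\<chi> i. w $ i \<bullet> u)"
    have "u \<bullet> u = \<delta> \<bullet> y"
      by (simp add: u_def[of] y_def signed_sum_def inner_sum_left inner_vec_def[of \<delta>])
    then have "(u \<bullet> u)\<^sup>2 \<le> (\<delta> \<bullet> \<delta>) * (y \<bullet> y)"
      using Cauchy_Schwarz_ineq[of \<delta> y] by simp
    also have "y \<bullet> y = 4 / 3 * (u \<bullet> u)"
      unfolding frame[rule_format, symmetric] inner_vec_def[of y] by (simp add: y_def power2_eq_square)
    finally have "(u \<bullet> u) * (u \<bullet> u) \<le> 16 / 3 * (u \<bullet> u)"
      using \<delta> by (simp add: sign_vector_inner_self power2_eq_square)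
    then show "(norm (signed_sum w \<delta>))\<^sup>2 \<le> 16 / 3"
      unfolding power2_norm_eq_inner u_def[symmetric]
      by (cases "u = 0") (simp_all add: mult_le_cancel_right)
  next
    define d where "d = f (axis 1 1)"
    have "norm d = 1"
      using sf(2) by (simp add: d_def orthogonal_transformation_norm)
    have "\<bar>d \<bullet> w $ i\<bar> = \<bar>s\<bar>" for i
    proof -
      obtain x where x: "x \<in> sign_vectors" "w $ i = s *\<^sub>R f x"
        using sf(3) by blast
      have "d \<bullet> w $ i = s * (axis 1 1 \<bullet> x)"
        using sf(2) by (simp add: d_def x(2) orthogonal_transformation_def)
      then show ?thesis
        using sign_vectors_abs[OF x(1), of 1] by (simp add: inner_axis' abs_mult)
    qed
    then have "(4 * \<bar>s\<bar>)\<^sup>2 \<le> max_sq_norm w"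
      using sum_abs_inner_le[OF \<open>norm d = 1\<close>, of w] by simp
    then show "16 / 3 \<le> max_sq_norm w"
      using sf(1) by (simp add: power_mult_distrib)
  qed
  then show ?thesis
    by (simp add: config_equiv_max_sq_norm[OF equiv])
qed

section \<open>The classification and the global minimum\<close>

theorem proposition2p6:
  shows "(\<forall>v\<in>configurations.
            attains_local_min_on configurations max_sq_norm v \<and>
            span {v $ 1, v $ 2, v $ 3, v $ 4} = UNIV \<and>
            (\<forall>i j. i \<noteq> j \<longrightarrow> v $ i \<noteq> v $ j \<and> v $ i \<noteq> - (v $ j))
            \<longrightarrow> cube_type v \<or> triangular_pyramid_type v)
       \<and> (\<forall>v\<in>configurations. cube_type v \<longrightarrow> max_sq_norm v = 16 / 3)
       \<and> (\<forall>v\<in>configurations. triangular_pyramid_type v \<longrightarrow> max_sq_norm v = 5)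
       \<and> (\<exists>v\<in>configurations. triangular_pyramid_type v)
       \<and> (\<forall>v\<in>configurations. triangular_pyramid_type v \<longrightarrow>
            (\<forall>w\<in>configurations. max_sq_norm v \<le> max_sq_norm w))
       \<and> (\<exists>v\<in>configurations. max_sq_norm v = 5)
       \<and> (\<forall>w\<in>configurations. 5 \<le> max_sq_norm w)"
proof -
  have pyramid: "triangular_pyramid_type v"
    if v: "v \<in> configurations" and min: "attains_local_min_on configurations max_sq_norm v"
      and span: "span (range (($) v)) = UNIV" for v
    using local_min_gram[OF v span min] triangular_pyramid_type_of_gram by metis
  obtain v0 where v0: "v0 \<in> configurations" "\<forall>w\<in>configurations. max_sq_norm v0 \<le> max_sq_norm w"
    using ex_global_minimum by blast
  have "5 \<le> max_sq_norm v0"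
  proof (cases "span (range (($) v0)) = UNIV")
    case True
    have "attains_local_min_on configurations max_sq_norm v0"
      unfolding attains_local_min_on_def using v0 by (intro exI[of _ configurations]) auto
    then show ?thesis
      using triangular_pyramid_value[OF v0(1) pyramid[OF v0(1) _ True]] by simp
  next
    case False
    then show ?thesis
      using coplanar_lower_bound[OF v0(1)] by simp
  qed
  then have bound: "5 \<le> max_sq_norm w" if "w \<in> configurations" for w
    using v0(2) that by (blast intro: order_trans)
  obtain p where p: "p \<in> configurations" "triangular_pyramid_type p"
    by (rule ex_triangular_pyramid)
  have range: "range (($) v) = {v $ 1, v $ 2, v $ 3, v $ 4}" for v :: "real^3^4"
    unfolding UNIV_4 by simp
  show ?thesis
  proof (intro conjI ballI impI)
    fix v :: "real^3^4"
    assume "v \<in> configurations" "attains_local_min_on configurations max_sq_norm v \<and>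
      span {v $ 1, v $ 2, v $ 3, v $ 4} = UNIV \<and>
      (\<forall>i j. i \<noteq> j \<longrightarrow> v $ i \<noteq> v $ j \<and> v $ i \<noteq> - (v $ j))"
    then show "cube_type v \<or> triangular_pyramid_type v"
      using pyramid[of v] by (simp add: range)
  next
    show "\<exists>v\<in>configurations. triangular_pyramid_type v" "\<exists>v\<in>configurations. max_sq_norm v = 5"
      using p triangular_pyramid_value by blast+
  next
    fix v w assume "v \<in> configurations" "triangular_pyramid_type v" "w \<in> configurations"
    then show "max_sq_norm v \<le> max_sq_norm w"
      by (simp add: triangular_pyramid_value bound)
  qed (simp_all add: cube_value triangular_pyramid_value bound)
qed

end
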